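(* Let $\Lambda$ be a finite, strongly connected $k$-graph and let $\delta\in(0,1)$. Suppose that $w_\delta(\lambda)=\operatorname{diam}[\lambda]$ for all $\lambda\in F\mathcal{B}_\Lambda$, where the diameter is taken with respect to $d_\delta$. Then the Dixmier trace induces a finite measure $\mu_\delta$ on $X_{\mathcal{B}_\Lambda}$; that is, for each $\gamma\in F\mathcal{B}_\Lambda$ the limit below exists and is finite, and there is a finite Borel measure $\mu_\delta$ on $X_{\mathcal{B}_\Lambda}$ with $$\mu_\delta([\gamma])=\lim_{s\searrow\delta}\frac{\sum_{\lambda\in F_\gamma\mathcal{B}_\Lambda}w_\delta(\lambda)^s}{\zeta_\delta(s)}\qquad\text{for all }\gamma\in F\mathcal{B}_\Lambda.$$
   Context: $\mathbb{N}=\{0,1,2,\dots\}$. A $k$-graph is a countable small category $\Lambda$ with a functor $d:\Lambda\to\mathbb{N}^k$ ($\mathbb{N}^k$ viewed as a one-object category) satisfying the factorization property: if $d(\lambda)=m+n$, there are unique $\mu,\nu\in\Lambda$ with $d(\mu)=m$, $d(\nu)=n$ and $\lambda=\mu\nu$. $r,s$ denote range and source of morphisms; $\Lambda^n=d^{-1}(n)$; $\Lambda^0$ is the set of vertices. $\Lambda$ is finite if every $\Lambda^n$ is finite, and strongly connected if for all $v,w\in\Lambda^0$ there is a morphism with range $v$ and source $w$. $A_i(v,w)=\#\{\lambda\in\Lambda^{e_i}: r(\lambda)=v,s(\lambda)=w\}$, and $\rho_i$ is the spectral radius of $A_i$. The Perron–Frobenius eigenvector $x^\Lambda\in(0,\infty)^{\Lambda^0}$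 is the unique positive vector with $\sum_v x^\Lambda_v=1$ and $A_ix^\Lambda=\rho_ix^\Lambda$ for all $i$. The stationary $k$-Bratteli diagram $\mathcal{B}_\Lambda$ has vertex set $\bigsqcup_{n\ge0}\mathcal{V}_n$, each $\mathcal{V}_n$ a copy of $\Lambda^0$, and edge set $\bigsqcup_{n\ge1}\mathcal{E}_n$; edges in $\mathcal{E}_n$ have source in $\mathcal{V}_n$ and range in $\mathcal{V}_{n-1}$, and if $n\equiv i\pmod k$ with $1\le i\le k$, there are $A_i(p,q)$ edges with range $p\in\mathcal{V}_{n-1}$ and source $q\in\mathcal{V}_n$. $X_{\mathcal{B}_\Lambda}$ is the set of infinite paths $(x_n)_{n\ge1}$, $x_n\in\mathcal{E}_n$, $s(x_n)=r(x_{n+1})$; $F\mathcal{B}_\Lambda$ is the set of finite paths with range in $\mathcal{V}_0$ (length-$0$ paths being vertices of $\mathcal{V}_0$); $|\eta|$ is length; $[\lambda]$ is the set of infinite paths with initial segment $\lambda$, and these cylinder sets generate the topology. $F_\gamma\mathcal{B}_\Lambda$ is the set of $\lambda\in F\mathcal{B}_\Lambda$ having $\gamma$ as initial segment. For $|\eta|=qk+t$ with $q,t\in\mathbb{N}$, $0\le t\le k-1$, $$w_\delta(\eta)=\left(\rho_1^{q+1}\cdots\rho_t^{q+1}\rho_{t+1}^q\cdots\rho_k^q\right)^{-1/\delta}x^\Lambda_{s(\eta)}.$$ The metric $d_\delta$ on $X_{\mathcal{B}_\Lambda}$ is: $d_\delta(x,x)=0$; $d_\delta(x,y)=1$ if $x,y$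 have no common initial segment in $F\mathcal{B}_\Lambda$; otherwise $d_\delta(x,y)=w_\delta(x\wedge y)$, $x\wedge y$ being the longest common initial segment. $\operatorname{diam}[\lambda]=\sup\{d_\delta(x,y):x,y\in[\lambda]\}$. $\zeta_\delta(s)=\sum_{\lambda\in F\mathcal{B}_\Lambda}w_\delta(\lambda)^s$ for real $s$; its abscissa of convergence is $\delta$. The displayed limit is the value at $\chi_{[\gamma]}$ of the Dixmier trace $a\mapsto\lim_{s\searrow\delta}\mathrm{Tr}(|D|^{-s}\pi(a))/\mathrm{Tr}(|D|^{-s})$ of the Pearson–Bellissard spectral triple of $(X_{\mathcal{B}_\Lambda},d_\delta)$. *)

theory Defs
  imports
    "HOL-Analysis.Analysis"
    "HOL-Library.Sublist"
    "Jordan_Normal_Form.Spectral_Radius"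
begin

text \<open>A small category is given by its morphisms alone: an object is identified with its
  identity morphism, so range and source are again morphisms.  Elements of \<open>\<nat>\<^sup>k\<close> are functions
  \<open>nat \<Rightarrow> nat\<close> that vanish outside \<open>{1..k}\<close>.\<close>

record 'a kgraph =
  rank :: nat
  mor :: "'a set"
  rng :: "'a \<Rightarrow> 'a"
  src :: "'a \<Rightarrow> 'a"
  comp :: "'a \<Rightarrow> 'a \<Rightarrow> 'a"
  deg :: "'a \<Rightarrow> nat \<Rightarrow> nat"

definition small_category :: "('a, 'b) kgraph_scheme \<Rightarrow> bool" where
  "small_category \<Lambda> \<longleftrightarrow>
     (\<forall>\<mu>\<in>mor \<Lambda>. rng \<Lambda> \<mu> \<in> mor \<Lambda> \<and> src \<Lambda> \<mu> \<in> mor \<Lambda>) \<and>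
     (\<forall>\<mu>\<in>mor \<Lambda>. rng \<Lambda> (rng \<Lambda> \<mu>) = rng \<Lambda> \<mu> \<and> src \<Lambda> (rng \<Lambda> \<mu>) = rng \<Lambda> \<mu> \<and>
                 rng \<Lambda> (src \<Lambda> \<mu>) = src \<Lambda> \<mu> \<and> src \<Lambda> (src \<Lambda> \<mu>) = src \<Lambda> \<mu>) \<and>
     (\<forall>\<mu>\<in>mor \<Lambda>. comp \<Lambda> (rng \<Lambda> \<mu>) \<mu> = \<mu> \<and> comp \<Lambda> \<mu> (src \<Lambda> \<mu>) = \<mu>) \<and>
     (\<forall>\<mu>\<in>mor \<Lambda>. \<forall>\<nu>\<in>mor \<Lambda>. src \<Lambda> \<mu> = rng \<Lambda> \<nu> \<longrightarrow>
        comp \<Lambda> \<mu> \<nu> \<in> mor \<Lambda> \<and> rng \<Lambda> (comp \<Lambda> \<mu> \<nu>) = rng \<Lambda> \<mu> \<and> src \<Lambda> (comp \<Lambda> \<mu> \<nu>) = src \<Lambda> \<nu>) \<and>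
     (\<forall>\<mu>\<in>mor \<Lambda>. \<forall>\<nu>\<in>mor \<Lambda>. \<forall>\<kappa>\<in>mor \<Lambda>. src \<Lambda> \<mu> = rng \<Lambda> \<nu> \<longrightarrow> src \<Lambda> \<nu> = rng \<Lambda> \<kappa> \<longrightarrow>
        comp \<Lambda> (comp \<Lambda> \<mu> \<nu>) \<kappa> = comp \<Lambda> \<mu> (comp \<Lambda> \<nu> \<kappa>))"

definition Nk :: "nat \<Rightarrow> (nat \<Rightarrow> nat) set" where
  "Nk k = {m. \<forall>i. i \<notin> {1..k} \<longrightarrow> m i = 0}"

definition unit_degree :: "nat \<Rightarrow> nat \<Rightarrow> nat" where
  "unit_degree i = (\<lambda>j. if j = i then 1 else 0)"

definition degree_functor :: "('a, 'b) kgraph_scheme \<Rightarrow> bool" where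
  "degree_functor \<Lambda> \<longleftrightarrow>
     (\<forall>\<mu>\<in>mor \<Lambda>. deg \<Lambda> \<mu> \<in> Nk (rank \<Lambda>)) \<and>
     (\<forall>\<mu>\<in>mor \<Lambda>. deg \<Lambda> (rng \<Lambda> \<mu>) = (\<lambda>_. 0) \<and> deg \<Lambda> (src \<Lambda> \<mu>) = (\<lambda>_. 0)) \<and>
     (\<forall>\<mu>\<in>mor \<Lambda>. \<forall>\<nu>\<in>mor \<Lambda>. src \<Lambda> \<mu> = rng \<Lambda> \<nu> \<longrightarrow>
        deg \<Lambda> (comp \<Lambda> \<mu> \<nu>) = (\<lambda>i. deg \<Lambda> \<mu> i + deg \<Lambda> \<nu> i))"

definition factorization_property :: "('a, 'b) kgraph_scheme \<Rightarrow> bool" where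
  "factorization_property \<Lambda> \<longleftrightarrow>
     (\<forall>\<kappa>\<in>mor \<Lambda>. \<forall>m\<in>Nk (rank \<Lambda>). \<forall>n\<in>Nk (rank \<Lambda>). deg \<Lambda> \<kappa> = (\<lambda>i. m i + n i) \<longrightarrow>
        (\<exists>!(\<mu>, \<nu>). \<mu> \<in> mor \<Lambda> \<and> \<nu> \<in> mor \<Lambda> \<and> src \<Lambda> \<mu> = rng \<Lambda> \<nu> \<and>
                    deg \<Lambda> \<mu> = m \<and> deg \<Lambda> \<nu> = n \<and> \<kappa> = comp \<Lambda> \<mu> \<nu>))"

definition k_graph :: "('a, 'b) kgraph_scheme \<Rightarrow> bool" where
  "k_graph \<Lambda> \<longleftrightarrow> 1 \<le> rank \<Lambda> \<and> countable (mor \<Lambda>) \<and> small_category \<Lambda> \<and>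
     degree_functor \<Lambda> \<and> factorization_property \<Lambda>"

definition mor_of_degree :: "('a, 'b) kgraph_scheme \<Rightarrow> (nat \<Rightarrow> nat) \<Rightarrow> 'a set" where
  "mor_of_degree \<Lambda> n = {\<mu> \<in> mor \<Lambda>. deg \<Lambda> \<mu> = n}"

definition vertices :: "('a, 'b) kgraph_scheme \<Rightarrow> 'a set" where
  "vertices \<Lambda> = mor_of_degree \<Lambda> (\<lambda>_. 0)"

definition finite_kgraph :: "('a, 'b) kgraph_scheme \<Rightarrow> bool" where
  "finite_kgraph \<Lambda> \<longleftrightarrow> (\<forall>n\<in>Nk (rank \<Lambda>). finite (mor_of_degree \<Lambda> n))"

definition strongly_connected :: "('a, 'b) kgraph_scheme \<Rightarrow> bool" where
  "strongly_connected \<Lambda> \<longleftrightarrow>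
     (\<forall>v\<in>vertices \<Lambda>. \<forall>w\<in>vertices \<Lambda>. \<exists>\<mu>\<in>mor \<Lambda>. rng \<Lambda> \<mu> = v \<and> src \<Lambda> \<mu> = w)"

definition adj :: "('a, 'b) kgraph_scheme \<Rightarrow> nat \<Rightarrow> 'a \<Rightarrow> 'a \<Rightarrow> nat" where
  "adj \<Lambda> i v w =
     card {\<mu> \<in> mor_of_degree \<Lambda> (unit_degree i). rng \<Lambda> \<mu> = v \<and> src \<Lambda> \<mu> = w}"

text \<open>\<open>from_nat_into\<close> restricts to a bijection from \<open>{..<card (vertices \<Lambda>)}\<close> to the finite set of
  vertices; the spectral radius does not depend on the enumeration.\<close>

definition adj_mat :: "('a, 'b) kgraph_scheme \<Rightarrow> nat \<Rightarrow> complex mat" where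
  "adj_mat \<Lambda> i =
     Matrix.mat (card (vertices \<Lambda>)) (card (vertices \<Lambda>))
       (\<lambda>(a, b). of_nat (adj \<Lambda> i (from_nat_into (vertices \<Lambda>) a) (from_nat_into (vertices \<Lambda>) b)))"

definition rho :: "('a, 'b) kgraph_scheme \<Rightarrow> nat \<Rightarrow> real" where
  "rho \<Lambda> i = spectral_radius (adj_mat \<Lambda> i)"

text \<open>A real vector indexed by the vertices is a function that is \<open>0\<close> at all non-vertices
  (so that it is unique).\<close>

definition is_pf_eigenvector :: "('a, 'b) kgraph_scheme \<Rightarrow> ('a \<Rightarrow> real) \<Rightarrow> bool" where
  "is_pf_eigenvector \<Lambda> x \<longleftrightarrow>
     (\<forall>v. v \<notin> vertices \<Lambda> \<longrightarrow> x v = 0) \<and>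
     (\<forall>v\<in>vertices \<Lambda>. 0 < x v) \<and>
     (\<Sum>v\<in>vertices \<Lambda>. x v) = 1 \<and>
     (\<forall>i\<in>{1..rank \<Lambda>}. \<forall>v\<in>vertices \<Lambda>.
        (\<Sum>w\<in>vertices \<Lambda>. real (adj \<Lambda> i v w) * x w) = rho \<Lambda> i * x v)"

definition pf_eigenvector :: "('a, 'b) kgraph_scheme \<Rightarrow> 'a \<Rightarrow> real" where
  "pf_eigenvector \<Lambda> = (THE x. is_pf_eigenvector \<Lambda> x)"

text \<open>The stationary Bratteli diagram: the copy of \<open>v\<close> at level \<open>n\<close> is \<open>(n, v)\<close>, and
  \<open>(n, p, q, j)\<close> is the edge number \<open>j\<close> at level \<open>n\<close> from \<open>(n, q)\<close> to \<open>(n - 1, p)\<close>.\<close>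

type_synonym 'a bvertex = "nat \<times> 'a"
type_synonym 'a bedge = "nat \<times> 'a \<times> 'a \<times> nat"

definition bvertices :: "('a, 'b) kgraph_scheme \<Rightarrow> nat \<Rightarrow> 'a bvertex set" where
  "bvertices \<Lambda> n = {n} \<times> vertices \<Lambda>"

text \<open>For \<open>n \<ge> 1\<close> this is the unique \<open>i \<in> {1..k}\<close> with \<open>n \<equiv> i (mod k)\<close>.\<close>

definition colour :: "('a, 'b) kgraph_scheme \<Rightarrow> nat \<Rightarrow> nat" where
  "colour \<Lambda> n = (n - 1) mod rank \<Lambda> + 1"

definition bedges :: "('a, 'b) kgraph_scheme \<Rightarrow> nat \<Rightarrow> 'a bedge set" where
  "bedges \<Lambda> n =
     {(n, p, q, j) | p q j. p \<in> vertices \<Lambda> \<and> q \<in> vertices \<Lambda> \<and> j < adj \<Lambda> (colour \<Lambda> n) p q}"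

fun brange :: "'a bedge \<Rightarrow> 'a bvertex" where
  "brange (n, p, q, j) = (n - 1, p)"

fun bsource :: "'a bedge \<Rightarrow> 'a bvertex" where
  "bsource (n, p, q, j) = (n, q)"

definition infinite_paths :: "('a, 'b) kgraph_scheme \<Rightarrow> (nat \<Rightarrow> 'a bedge) set" where
  "infinite_paths \<Lambda> =
     {x \<in> (\<Pi>\<^sub>E n\<in>{1..}. bedges \<Lambda> n). \<forall>n\<ge>1. bsource (x n) = brange (x (n + 1))}"

text \<open>A finite path is its range in level \<open>0\<close> together with its list of edges, so that the paths of
  length \<open>0\<close> are the vertices of level \<open>0\<close>.\<close>

type_synonym 'a bpath = "'a bvertex \<times> 'a bedge list"

definition finite_paths :: "('a, 'b) kgraph_scheme \<Rightarrow> 'a bpath set" where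
  "finite_paths \<Lambda> =
     {(v, es). v \<in> bvertices \<Lambda> 0 \<and>
        (\<forall>i<length es. es ! i \<in> bedges \<Lambda> (i + 1)) \<and>
        (es \<noteq> [] \<longrightarrow> brange (hd es) = v) \<and>
        (\<forall>i. i + 1 < length es \<longrightarrow> bsource (es ! i) = brange (es ! (i + 1)))}"

definition path_length :: "'a bpath \<Rightarrow> nat" where
  "path_length \<eta> = length (snd \<eta>)"

definition path_source :: "'a bpath \<Rightarrow> 'a bvertex" where
  "path_source \<eta> = (if snd \<eta> = [] then fst \<eta> else bsource (last (snd \<eta>)))"

definition cylinder :: "('a, 'b) kgraph_scheme \<Rightarrow> 'a bpath \<Rightarrow> (nat \<Rightarrow> 'a bedge) set" where
  "cylinder \<Lambda> \<eta> =
     {x \<in> infinite_paths \<Lambda>. brange (x 1) = fst \<eta> \<and> (\<forall>i<path_length \<eta>. x (i + 1) = snd \<eta> ! i)}"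

definition extensions :: "('a, 'b) kgraph_scheme \<Rightarrow> 'a bpath \<Rightarrow> 'a bpath set" where
  "extensions \<Lambda> \<gamma> = {\<eta> \<in> finite_paths \<Lambda>. fst \<eta> = fst \<gamma> \<and> prefix (snd \<gamma>) (snd \<eta>)}"

definition path_topology :: "('a, 'b) kgraph_scheme \<Rightarrow> (nat \<Rightarrow> 'a bedge) topology" where
  "path_topology \<Lambda> = topology_generated_by (cylinder \<Lambda> ` finite_paths \<Lambda>)"

definition path_borel_sets :: "('a, 'b) kgraph_scheme \<Rightarrow> (nat \<Rightarrow> 'a bedge) set set" where
  "path_borel_sets \<Lambda> = sigma_sets (infinite_paths \<Lambda>) {U. openin (path_topology \<Lambda>) U}"

definition weight :: "('a, 'b) kgraph_scheme \<Rightarrow> real \<Rightarrow> 'a bpath \<Rightarrow> real" where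
  "weight \<Lambda> \<delta> \<eta> =
     (let q = path_length \<eta> div rank \<Lambda>; t = path_length \<eta> mod rank \<Lambda>
      in ((\<Prod>i\<in>{1..t}. rho \<Lambda> i ^ (q + 1)) * (\<Prod>i\<in>{t + 1..rank \<Lambda>}. rho \<Lambda> i ^ q)) powr (- 1 / \<delta>)
         * pf_eigenvector \<Lambda> (snd (path_source \<eta>)))"

definition common_segments ::
  "('a, 'b) kgraph_scheme \<Rightarrow> (nat \<Rightarrow> 'a bedge) \<Rightarrow> (nat \<Rightarrow> 'a bedge) \<Rightarrow> 'a bpath set" where
  "common_segments \<Lambda> x y = {\<eta> \<in> finite_paths \<Lambda>. x \<in> cylinder \<Lambda> \<eta> \<and> y \<in> cylinder \<Lambda> \<eta>}"

definition meet ::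
  "('a, 'b) kgraph_scheme \<Rightarrow> (nat \<Rightarrow> 'a bedge) \<Rightarrow> (nat \<Rightarrow> 'a bedge) \<Rightarrow> 'a bpath" where
  "meet \<Lambda> x y = (ARG_MAX path_length \<eta>. \<eta> \<in> common_segments \<Lambda> x y)"

definition path_dist ::
  "('a, 'b) kgraph_scheme \<Rightarrow> real \<Rightarrow> (nat \<Rightarrow> 'a bedge) \<Rightarrow> (nat \<Rightarrow> 'a bedge) \<Rightarrow> real" where
  "path_dist \<Lambda> \<delta> x y =
     (if x = y then 0
      else if common_segments \<Lambda> x y = {} then 1
      else weight \<Lambda> \<delta> (meet \<Lambda> x y))"

text \<open>The supremum is taken in \<open>[0, \<infinity>)\<close>, so the empty set has diameter \<open>0\<close>
  (whereas \<open>Sup {}\<close> is unspecified on the reals).\<close>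

definition path_diam ::
  "('a, 'b) kgraph_scheme \<Rightarrow> real \<Rightarrow> (nat \<Rightarrow> 'a bedge) set \<Rightarrow> real" where
  "path_diam \<Lambda> \<delta> S = (if S = {} then 0 else Sup {path_dist \<Lambda> \<delta> x y | x y. x \<in> S \<and> y \<in> S})"

definition zeta :: "('a, 'b) kgraph_scheme \<Rightarrow> real \<Rightarrow> real \<Rightarrow> real" where
  "zeta \<Lambda> \<delta> s = (\<Sum>\<^sub>\<infinity>\<eta>\<in>finite_paths \<Lambda>. weight \<Lambda> \<delta> \<eta> powr s)"

end

theory Submission
  imports Defs
begin

text \<open>Let \<open>x\<close> be the Perron--Frobenius vector and \<open>R\<close> the product of the spectral radii. At a vertex
  where \<open>x\<close> is minimal every spectral radius is at least \<open>1\<close>, and if \<open>R = 1\<close> only one infinite path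
  leaves it; then a cylinder of positive weight would be a singleton, against the diameter condition.
  So \<open>R > 1\<close>.

  The sum \<open>S\<close> over the extensions of a path depends only on its length \<open>m\<close> and its source. Splitting
  off the first \<open>k\<close> levels gives \<open>S = y + r G S\<close>, where \<open>r = R powr (1 - s / \<delta>)\<close> tends to \<open>1\<close> from
  below, \<open>y\<close> converges, and \<open>G\<close>, the product of the next \<open>k\<close> vertex matrices divided by \<open>R\<close>, is a
  positive operator fixing \<open>x\<close>. That product may be periodic or even reducible, so the
  convergence of \<open>(1 - r) S\<close> is a mean ergodic statement rather than a consequence of the
  Perron--Frobenius theorem. The limits are additive over the one-edge extensions of a path, because the
  weight of the path itself is killed by the factor \<open>1 - r\<close>, and by compactness they extend to a
  measure.\<close>

section \<open>Positive matrices\<close>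

text \<open>The vector \<open>pf_eigenvector\<close> is a definite description, so it has to be
  shown that exactly one such vector exists. Strong connectivity need not make any single vertex
  matrix irreducible; it only makes a sum of path-count matrices, over finitely many degrees,
  strictly positive. By the factorization property this sum commutes with every vertex matrix, and
  the uniqueness of its eigenvector up to scaling turns that vector into a common eigenvector. The
  weights carry \<open>x powr s\<close>, which in general is not an eigenvector. On the finite
  vertex set it lies between two positive multiples of \<open>x\<close>; this comparison supplies
  both the convergence of all sums for \<open>s > \<delta>\<close> and the positivity of the limit
  by which one has to divide. The diameter condition also shows that all spectral radii are positive
  and all cylinders nonempty, since the empty set has diameter \<open>0\<close> just like a
  singleton. Nonempty cylinders are what allows an additive function on finite paths to be read as a
  function on sets of infinite paths.\<close>

lemma finite_bounded_convergent_subseq: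
  fixes f :: "nat \<Rightarrow> 'a \<Rightarrow> real"
  assumes "finite V" and "\<And>v. v \<in> V \<Longrightarrow> Bseq (\<lambda>n. f n v)"
  shows "\<exists>(r::nat \<Rightarrow> nat) l. strict_mono r \<and> (\<forall>v\<in>V. (\<lambda>n. f (r n) v) \<longlonglongrightarrow> l v)"
  using assms
proof (induction V)
  case empty
  show ?case by (intro exI[of _ id]) (auto simp: strict_mono_def)
next
  case (insert u V)
  then obtain r l where r: "strict_mono r" and l: "\<And>v. v \<in> V \<Longrightarrow> (\<lambda>n. f (r n) v) \<longlonglongrightarrow> l v"
    by (metis insertCI)
  obtain K where "\<And>n. norm (f n u) \<le> K"
    using insert.prems[of u] unfolding Bseq_def by blast
  then have "bounded (range (\<lambda>n. f (r n) u))"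
    unfolding bounded_iff by blast
  then obtain c r' where r': "strict_mono r'" and c: "(\<lambda>n. f (r (r' n)) u) \<longlonglongrightarrow> c"
    using bounded_imp_convergent_subsequence[of "\<lambda>n. f (r n) u"] by (auto simp: o_def)
  have "(\<lambda>n. f (r (r' n)) v) \<longlonglongrightarrow> l v" if "v \<in> V" for v
    using LIMSEQ_subseq_LIMSEQ[OF l[OF that] r'] by (simp add: o_def)
  then have "\<forall>v\<in>insert u V. (\<lambda>n. f ((r \<circ> r') n) v) \<longlonglongrightarrow> (l(u := c)) v"
    using c insert.hyps by auto
  then show ?case
    using strict_mono_o[OF r r'] by blast
qed

lemma positive_matrix_apply_pos:
  fixes M :: "'a \<Rightarrow> 'a \<Rightarrow> real"
  assumes "finite V" and "\<And>v w. v \<in> V \<Longrightarrow> w \<in> V \<Longrightarrow> 0 < M v w"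
    and "\<And>v. v \<in> V \<Longrightarrow> 0 \<le> z v" and "u \<in> V" "0 < z u" and "v \<in> V"
  shows "0 < (\<Sum>w\<in>V. M v w * z w)"
proof (rule sum_pos2[where i = u])
  show "0 \<le> M v w * z w" if "w \<in> V" for w
    using assms(2)[OF assms(6) that] assms(3)[OF that] by simp
qed (use assms in auto)

text \<open>The eigenvalue is the largest \<open>t\<close> such that \<open>t x \<le> M x\<close> for some probability vector \<open>x\<close>: if
  the inequality were strict somewhere for the maximal \<open>t\<close>, it would be strict everywhere for \<open>M x\<close>.\<close>

lemma positive_matrix_eigenvector:
  fixes M :: "'a \<Rightarrow> 'a \<Rightarrow> real"
  assumes V: "finite V" "V \<noteq> {}" and M: "\<And>v w. v \<in> V \<Longrightarrow> w \<in> V \<Longrightarrow> 0 < M v w"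
  shows "\<exists>x l. (\<forall>v\<in>V. 0 < x v) \<and> (\<forall>v\<in>V. (\<Sum>w\<in>V. M v w * x w) = l * x v)"
proof -
  define S where "S = {t. \<exists>x. (\<forall>v\<in>V. 0 \<le> x v) \<and> sum x V = 1 \<and> (\<forall>v\<in>V. t * x v \<le> (\<Sum>w\<in>V. M v w * x w))}"
  define C where "C = (\<Sum>v\<in>V. \<Sum>w\<in>V. M v w)"
  have M0: "0 \<le> M v w" if "v \<in> V" "w \<in> V" for v w
    using M[OF that] by simp
  have le1: "x v \<le> 1" if "\<forall>v\<in>V. 0 \<le> x v" "sum x V = 1" "v \<in> V" for x :: "'a \<Rightarrow> real" and v
    using member_le_sum[of v V x] that V by auto
  have S0: "0 \<in> S"
    unfolding S_def mem_Collect_eq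
    by (rule exI[of _ "\<lambda>_. 1 / card V"])
       (use V M0 in \<open>auto intro!: sum_nonneg divide_nonneg_nonneg\<close>)
  have bdd: "bdd_above S"
  proof (rule bdd_aboveI[of _ C])
    fix t assume "t \<in> S"
    then obtain x where x: "\<forall>v\<in>V. 0 \<le> x v" "sum x V = 1" "\<forall>v\<in>V. t * x v \<le> (\<Sum>w\<in>V. M v w * x w)"
      unfolding S_def by blast
    have "t = (\<Sum>v\<in>V. t * x v)" using x(2) by (simp flip: sum_distrib_left)
    also have "\<dots> \<le> (\<Sum>v\<in>V. \<Sum>w\<in>V. M v w * x w)" using x(3) by (intro sum_mono) auto
    also have "\<dots> \<le> C"
      unfolding C_def using M0 le1[OF x(1,2)]
      by (intro sum_mono mult_left_le)
    finally show "t \<le> C" .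
  qed
  define l where "l = Sup S"
  \<comment> \<open>The supremum is attained: witnesses for values tending to \<open>l\<close> are
    probability vectors on a finite set, so a subsequence of them converges.\<close>
  have "l \<in> closure S"
    unfolding l_def using S0 bdd by (intro closure_contains_Sup) auto
  then obtain t where t: "\<And>n. t n \<in> S" "t \<longlonglongrightarrow> l"
    unfolding closure_sequential by blast
  then obtain y where y: "\<And>n. (\<forall>v\<in>V. 0 \<le> y n v) \<and> sum (y n) V = 1 \<and>
      (\<forall>v\<in>V. t n * y n v \<le> (\<Sum>w\<in>V. M v w * y n w))"
    unfolding S_def mem_Collect_eq by metis
  have "Bseq (\<lambda>n. y n v)" if "v \<in> V" for v
    using y le1 that by (intro BseqI'[of _ 1]) (auto simp: abs_le_iff intro: order_trans[of _ 0])
  then obtain r x where r: "strict_mono r" and lim: "\<And>v. v \<in> V \<Longrightarrow> (\<lambda>n. y (r n) v) \<longlonglongrightarrow> x v"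
    using finite_bounded_convergent_subseq[OF V(1), of y] by auto
  have tr: "(\<lambda>n. t (r n)) \<longlonglongrightarrow> l"
    using LIMSEQ_subseq_LIMSEQ[OF t(2) r] by (simp add: o_def)
  have x0: "0 \<le> x v" if "v \<in> V" for v
    by (rule LIMSEQ_le_const[OF lim[OF that]]) (use y that in auto)
  have "(\<lambda>n. sum (y (r n)) V) \<longlonglongrightarrow> sum x V"
    by (intro tendsto_sum lim)
  then have x1: "sum x V = 1"
    using y LIMSEQ_unique by (metis (no_types, lifting) LIMSEQ_const_iff ext)
  have xle: "l * x v \<le> (\<Sum>w\<in>V. M v w * x w)" if v: "v \<in> V" for v
  proof (rule LIMSEQ_le)
    show "(\<lambda>n. t (r n) * y (r n) v) \<longlonglongrightarrow> l * x v"
      by (intro tendsto_intros lim tr v)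
    show "(\<lambda>n. \<Sum>w\<in>V. M v w * y (r n) w) \<longlonglongrightarrow> (\<Sum>w\<in>V. M v w * x w)"
      by (intro tendsto_intros lim)
  qed (use y v in blast)
  obtain u where u: "u \<in> V" "0 < x u"
    using x1 x0 by (metis less_eq_real_def sum.neutral zero_neq_one)
  define z where "z v = (\<Sum>w\<in>V. M v w * x w)" for v
  have zpos: "0 < z v" if "v \<in> V" for v
    unfolding z_def using positive_matrix_apply_pos[of V M x u v] V(1) M x0 u that by blast
  have eq: "z v = l * x v" if "v \<in> V" for v
  proof (rule ccontr)
    assume "z v \<noteq> l * x v"
    then have "0 < z v - l * x v" using xle[OF that] unfolding z_def by simp
    then have pos: "0 < (\<Sum>w\<in>V. M v' w * (z w - l * x w))" if "v' \<in> V" for v'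
      using positive_matrix_apply_pos[OF V(1), of M "\<lambda>w. z w - l * x w" v v'] M xle that \<open>v \<in> V\<close>
      unfolding z_def by auto
    \<comment> \<open>The smallest Collatz-Wielandt quotient of \<open>z = M x\<close>. Normalised,
      \<open>z\<close> witnesses \<open>t \<in> S\<close>, while \<open>pos\<close> makes
      \<open>t\<close> exceed \<open>l\<close>.\<close>
    define t where "t = Min ((\<lambda>v. (\<Sum>w\<in>V. M v w * z w) / z v) ` V)"
    have "t \<in> (\<lambda>v. (\<Sum>w\<in>V. M v w * z w) / z v) ` V"
      unfolding t_def using V by (intro Min_in) auto
    then obtain v' where v': "v' \<in> V" "t = (\<Sum>w\<in>V. M v' w * z w) / z v'" by blast
    have "(\<Sum>w\<in>V. M v' w * (z w - l * x w)) = (\<Sum>w\<in>V. M v' w * z w) - l * z v'"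
      by (simp add: algebra_simps sum_subtractf sum_distrib_left z_def[of v'])
    with pos[OF v'(1)] have "l < t"
      using zpos[OF v'(1)] by (simp add: v'(2) less_divide_eq)
    moreover have "t \<in> S"
      unfolding S_def mem_Collect_eq
    proof (intro exI[of _ "\<lambda>v. z v / sum z V"] conjI ballI)
      have sz: "0 < sum z V" using V zpos by (intro sum_pos) auto
      show "(\<Sum>v\<in>V. z v / sum z V) = 1"
        using sz by (simp flip: sum_divide_distrib)
      fix v assume v: "v \<in> V"
      show "0 \<le> z v / sum z V" using sz zpos[OF v] by simp
      have "t \<le> (\<Sum>w\<in>V. M v w * z w) / z v"
        unfolding t_def using V v by (intro Min_le) auto
      then have "t * z v \<le> (\<Sum>w\<in>V. M v w * z w)"
        using zpos[OF v] by (simp add: le_divide_eq)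
      then have "t * z v / sum z V \<le> (\<Sum>w\<in>V. M v w * z w) / sum z V"
        using sz by (intro divide_right_mono) auto
      then show "t * (z v / sum z V) \<le> (\<Sum>w\<in>V. M v w * (z w / sum z V))"
        by (simp add: sum_divide_distrib)
    qed
    ultimately show False
      using cSup_upper[OF _ bdd] unfolding l_def by force
  qed
  have "0 < l"
    using eq[OF u(1)] zpos[OF u(1)] u(2) by (simp add: zero_less_mult_iff)
  then have "0 < x v" if "v \<in> V" for v
    using eq[OF that] zpos[OF that] by (simp add: zero_less_mult_iff)
  then show ?thesis
    using eq unfolding z_def by blast
qed

text \<open>Subtract from \<open>y\<close> the largest multiple of \<open>x\<close> below it. The
  difference is nonnegative and vanishes at some \<open>u\<close>; if it were nonzero, the positive
  matrix would make its image positive at \<open>u\<close>, but that image is \<open>l\<close> times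
  the difference.\<close>

lemma positive_matrix_eigenvector_unique:
  fixes M :: "'a \<Rightarrow> 'a \<Rightarrow> real"
  assumes V: "finite V" "V \<noteq> {}" and M: "\<And>v w. v \<in> V \<Longrightarrow> w \<in> V \<Longrightarrow> 0 < M v w"
    and x: "\<And>v. v \<in> V \<Longrightarrow> 0 < x v" "\<And>v. v \<in> V \<Longrightarrow> (\<Sum>w\<in>V. M v w * x w) = l * x v"
    and y: "\<And>v. v \<in> V \<Longrightarrow> (\<Sum>w\<in>V. M v w * y w) = l * y v"
  shows "\<exists>c. \<forall>v\<in>V. y v = c * x v"
proof -
  define c where "c = Min ((\<lambda>v. y v / x v) ` V)"
  have "c \<in> (\<lambda>v. y v / x v) ` V"
    unfolding c_def using V by (intro Min_in) auto
  then obtain u where u: "u \<in> V" "y u = c * x u" using x(1) by force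
  have ge: "0 \<le> y v - c * x v" if "v \<in> V" for v
  proof -
    have "c \<le> y v / x v" unfolding c_def using V that by (intro Min_le) auto
    then show ?thesis using x(1)[OF that] by (simp add: le_divide_eq)
  qed
  have "y v = c * x v" if "v \<in> V" for v
  proof (rule ccontr)
    assume "y v \<noteq> c * x v"
    then have "0 < y v - c * x v" using ge[OF that] by simp
    then have "0 < (\<Sum>w\<in>V. M u w * (y w - c * x w))"
      using positive_matrix_apply_pos[of V M "\<lambda>v. y v - c * x v" v u] V(1) M ge that u(1) by blast
    also have "\<dots> = l * (y u - c * x u)"
      using x(2)[OF u(1)] y[OF u(1)]
      by (simp add: algebra_simps sum_subtractf flip: sum_distrib_left)
    finally show False using u(2) by simp
  qed
  then show ?thesis by blast
qed

section \<open>Abel means of positive operators\<close>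

text \<open>The positive fixed vector \<open>x\<close> serves as order unit: \<open>G\<close> is a
  contraction for the norm given by the maximum of \<open>\<bar>f v\<bar> / x v\<close>. The norm
  itself never appears; it is expressed by bounds of the form
  \<open>\<bar>f v\<bar> \<le> K * x v\<close>.\<close>

locale positive_operator =
  fixes V :: "'a set" and x :: "'a \<Rightarrow> real" and G :: "('a \<Rightarrow> real) \<Rightarrow> 'a \<Rightarrow> real"
  assumes fin: "finite V" and nonempty: "V \<noteq> {}"
    and x_pos: "\<And>v. v \<in> V \<Longrightarrow> 0 < x v"
    and lin: "\<And>a b f g v. v \<in> V \<Longrightarrow> G (\<lambda>w. a * f w + b * g w) v = a * G f v + b * G g v"
    and nonneg: "\<And>f v. (\<And>w. w \<in> V \<Longrightarrow> 0 \<le> f w) \<Longrightarrow> v \<in> V \<Longrightarrow> 0 \<le> G f v"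
    and fix_x: "\<And>v. v \<in> V \<Longrightarrow> G x v = x v"
begin

text \<open>A minimum principle in place of a Neumann series: where \<open>u / x\<close> attains its
  minimum \<open>c\<close>, positivity gives \<open>G u \<ge> c x\<close>, so
  \<open>c x \<ge> r c x\<close> and therefore \<open>c \<ge> 0\<close>.\<close>

lemma resolvent_nonneg:
  assumes r: "0 \<le> r" "r < 1" and u: "\<And>v. v \<in> V \<Longrightarrow> u v = f v + r * G u v"
    and f: "\<And>v. v \<in> V \<Longrightarrow> 0 \<le> f v" and v: "v \<in> V"
  shows "0 \<le> u v"
proof -
  define c where "c = Min ((\<lambda>v. u v / x v) ` V)"
  have "c \<in> (\<lambda>v. u v / x v) ` V"
    unfolding c_def using fin nonempty by (intro Min_in) auto
  then obtain v0 where v0: "v0 \<in> V" "u v0 = c * x v0" using x_pos by force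
  have ge: "c * x v \<le> u v" if "v \<in> V" for v
  proof -
    have "c \<le> u v / x v" unfolding c_def using fin that by (intro Min_le) auto
    then show ?thesis using x_pos[OF that] by (simp add: le_divide_eq)
  qed
  have "0 \<le> G (\<lambda>w. 1 * u w + (- c) * x w) v0"
    using ge by (intro nonneg v0(1)) (auto)
  then have "c * x v0 \<le> G u v0"
    using lin[OF v0(1), of 1 u "-c" x] fix_x[OF v0(1)] by simp
  then have "r * (c * x v0) \<le> r * G u v0" using r by (intro mult_left_mono)
  then have "r * (c * x v0) \<le> c * x v0"
    using u[OF v0(1)] f[OF v0(1)] v0(2) by simp
  then have "0 \<le> (1 - r) * c * x v0" by (simp add: algebra_simps)
  then have "0 \<le> c" using r x_pos[OF v0(1)] by (simp add: zero_le_mult_iff)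
  then show ?thesis using ge[OF v] x_pos[OF v] by (meson mult_nonneg_nonneg less_imp_le order_trans)
qed

text \<open>Since \<open>x\<close> is fixed, \<open>K / (1 - r) * x\<close> solves the equation with
  right-hand side \<open>K * x\<close>; the minimum principle is applied to its sum and difference
  with \<open>u\<close>.\<close>

lemma resolvent_bound:
  assumes r: "0 \<le> r" "r < 1" and u: "\<And>v. v \<in> V \<Longrightarrow> u v = f v + r * G u v"
    and f: "\<And>v. v \<in> V \<Longrightarrow> \<bar>f v\<bar> \<le> K * x v" and v: "v \<in> V"
  shows "(1 - r) * \<bar>u v\<bar> \<le> K * x v"
proof -
  have *: "0 \<le> K / (1 - r) * x v + c * u v" if c: "c = 1 \<or> c = -1" for c
  proof (rule resolvent_nonneg[OF r, where f = "\<lambda>v. K * x v + c * f v", OF _ _ v])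
    fix v assume v: "v \<in> V"
    show "0 \<le> K * x v + c * f v" using f[OF v] c by (auto simp: abs_le_iff)
    have K: "K / (1 - r) * x v = K * x v + r * (K / (1 - r) * x v)"
      using r by (simp add: field_simps)
    then show "K / (1 - r) * x v + c * u v
        = K * x v + c * f v + r * G (\<lambda>v. K / (1 - r) * x v + c * u v) v"
      unfolding lin[OF v] fix_x[OF v]
      by (subst u[OF v], subst K) (simp only: distrib_left add_ac mult_ac)
  qed
  have "\<bar>u v\<bar> \<le> K / (1 - r) * x v" using *[of 1] *[of "-1"] by (auto simp: abs_le_iff)
  then show ?thesis using r by (simp add: field_simps)
qed

lemma apply_bound:
  assumes f: "\<And>w. w \<in> V \<Longrightarrow> \<bar>f w\<bar> \<le> K * x w" and v: "v \<in> V"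
  shows "\<bar>G f v\<bar> \<le> K * x v"
proof -
  have *: "0 \<le> K * x v + c * G f v" if c: "c = 1 \<or> c = -1" for c
  proof -
    have "0 \<le> G (\<lambda>w. K * x w + c * f w) v"
      using c by (intro nonneg v) (auto dest!: f)
    then show ?thesis by (simp only: lin[OF v] fix_x[OF v])
  qed
  show ?thesis using *[of 1] *[of "-1"] by (auto simp: abs_le_iff)
qed

text \<open>Continuity comes from the contraction bound; \<open>e n\<close> dominates the norm of
  \<open>f n - l\<close> relative to \<open>x\<close> and is a finite sum of null sequences.\<close>

lemma tendsto_apply:
  assumes "\<And>v. v \<in> V \<Longrightarrow> ((\<lambda>n. f n v) \<longlongrightarrow> l v) F" and v: "v \<in> V"
  shows "((\<lambda>n. G (f n) v) \<longlongrightarrow> G l v) F"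
proof -
  define e where "e n = (\<Sum>w\<in>V. \<bar>f n w - l w\<bar> / x w)" for n
  have "(e \<longlongrightarrow> (\<Sum>w\<in>V. \<bar>l w - l w\<bar> / x w)) F"
    unfolding e_def using assms(1) by (intro tendsto_intros) (auto dest: x_pos)
  then have e0: "(e \<longlongrightarrow> 0) F" by simp
  have bd: "\<bar>f n w - l w\<bar> \<le> e n * x w" if "w \<in> V" for n w
  proof -
    have "\<bar>f n w - l w\<bar> / x w \<le> e n"
      unfolding e_def using that fin x_pos
      by (intro member_le_sum) (auto intro!: divide_nonneg_pos)
    then show ?thesis using x_pos[OF that] by (simp add: divide_le_eq)
  qed
  have "\<bar>G (f n) v - G l v\<bar> \<le> e n * x v" for n
    using apply_bound[of "\<lambda>w. 1 * f n w + (- 1) * l w" "e n" v] bd v lin[OF v, of 1 "f n" "-1" l]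
    by simp
  moreover have "((\<lambda>n. e n * x v) \<longlongrightarrow> 0 * x v) F" by (intro tendsto_intros e0)
  ultimately have "((\<lambda>n. G (f n) v - G l v) \<longlongrightarrow> 0) F"
    using Lim_null_comparison[of "\<lambda>n. G (f n) v - G l v" "\<lambda>n. e n * x v" F] by simp
  then show ?thesis by (simp add: LIM_zero_iff)
qed

lemma exists_bound:
  obtains K where "\<And>v. v \<in> V \<Longrightarrow> \<bar>f v\<bar> \<le> K * x v"
proof -
  have "\<bar>f v\<bar> \<le> (\<Sum>w\<in>V. \<bar>f w\<bar> / x w) * x v" if "v \<in> V" for v
  proof -
    have "\<bar>f v\<bar> / x v \<le> (\<Sum>w\<in>V. \<bar>f w\<bar> / x w)"
      using that fin x_pos by (intro member_le_sum) (auto intro!: divide_nonneg_pos)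
    then show ?thesis using x_pos[OF that] by (simp add: divide_le_eq)
  qed
  then show thesis using that by blast
qed

text \<open>This is the mean ergodic theorem. A sequence of the functions \<open>(1 - r) S\<close> converges to some
  \<open>a\<close> by compactness, and \<open>G a = a\<close>. The function \<open>y - a\<close> is close to one of the form \<open>z - G z\<close>, on
  which the normalised resolvent tends to \<open>0\<close>; hence the full limit exists.\<close>

lemma resolvent_convergent:
  fixes S y :: "real \<Rightarrow> 'a \<Rightarrow> real"
  assumes r: "\<And>s. d < s \<Longrightarrow> 0 \<le> r s \<and> r s < 1" and r1: "(r \<longlongrightarrow> 1) (at_right d)"
    and S: "\<And>s v. d < s \<Longrightarrow> v \<in> V \<Longrightarrow> S s v = y s v + r s * G (S s) v"
    and y: "\<And>v. v \<in> V \<Longrightarrow> ((\<lambda>s. y s v) \<longlongrightarrow> y0 v) (at_right d)"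
  shows "\<exists>a. \<forall>v\<in>V. ((\<lambda>s. (1 - r s) * S s v) \<longlongrightarrow> a v) (at_right d)"
proof -
  define A where "A s v = (1 - r s) * S s v" for s v
  \<comment> \<open>The added \<open>1\<close> absorbs the distance of \<open>y s\<close> from
    \<open>y0\<close> on an interval to the right of \<open>d\<close>, so a single \<open>K\<close>
    serves for all \<open>s\<close> there.\<close>
  obtain K where K: "\<And>v. v \<in> V \<Longrightarrow> \<bar>\<bar>y0 v\<bar> + 1\<bar> \<le> K * x v"
    using exists_bound[of "\<lambda>v. \<bar>y0 v\<bar> + 1"] by blast
  have "\<forall>\<^sub>F s in at_right d. \<forall>v\<in>V. dist (y s v) (y0 v) < 1"
    using fin y by (intro eventually_ball_finite) (auto simp: tendsto_iff)
  then obtain b where b: "d < b" "\<And>s v. d < s \<Longrightarrow> s < b \<Longrightarrow> v \<in> V \<Longrightarrow> dist (y s v) (y0 v) < 1"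
    unfolding eventually_at_right_field by blast
  have yK: "\<bar>y s v\<bar> \<le> K * x v" if "d < s" "s < b" "v \<in> V" for s v
    using b(2)[OF that] K[OF that(3)] by (simp add: dist_real_def)
  have AK: "\<bar>A s v\<bar> \<le> K * x v" if "d < s" "s < b" "v \<in> V" for s v
    using resolvent_bound[of "r s" "S s" "y s" K v] r[OF that(1)] S[OF that(1)] yK[OF that(1,2)] that(3)
    unfolding A_def by (simp add: abs_mult)
  define q where "q n = d + (b - d) / real (n + 2)" for n
  have q: "d < q n" "q n < b" for n
    using b(1) mult_right_mono[of d b "real n"] by (auto simp: q_def field_simps)
  have "(\<lambda>n. (b - d) * inverse (real (n + 2))) \<longlonglongrightarrow> (b - d) * 0"
    by (intro tendsto_mult tendsto_const LIMSEQ_ignore_initial_segment lim_inverse_n)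
  then have "q \<longlonglongrightarrow> d + 0"
    unfolding q_def by (intro tendsto_add) (simp_all add: divide_inverse)
  moreover have "q n \<noteq> d" for n using q(1)[of n] by auto
  ultimately have qlim: "filterlim q (at_right d) sequentially"
    using q(1) by (simp add: filterlim_at)
  have "Bseq (\<lambda>n. A (q n) v)" if "v \<in> V" for v
    using AK[OF q that] by (intro BseqI'[of _ "K * x v"]) simp
  then obtain p :: "nat \<Rightarrow> nat" and a where p: "strict_mono p"
    and a: "\<And>v. v \<in> V \<Longrightarrow> (\<lambda>n. A (q (p n)) v) \<longlonglongrightarrow> a v"
    using finite_bounded_convergent_subseq[OF fin, of "\<lambda>n. A (q n)"] by auto
  define t where "t n = q (p n)" for n
  have t: "d < t n" for n by (simp add: t_def q)
  have tlim: "filterlim t (at_right d) sequentially"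
    unfolding t_def using filterlim_compose[OF qlim filterlim_subseq[OF p]] by simp
  have at: "(\<lambda>n. A (t n) v) \<longlonglongrightarrow> a v" if "v \<in> V" for v
    using a[OF that] by (simp add: t_def)
  \<comment> \<open>Multiplied by \<open>1 - r s\<close>, the resolvent equation loses its
    inhomogeneous term in the limit along \<open>t\<close>.\<close>
  have Ga: "G a v = a v" if v: "v \<in> V" for v
  proof -
    have "A s v = (1 - r s) * y s v + r s * G (A s) v" if "d < s" for s
    proof -
      have "G (A s) v = (1 - r s) * G (S s) v"
        using lin[OF v, of "1 - r s" "S s" 0 "S s"] unfolding A_def by simp
      then show ?thesis
        unfolding A_def[of s v] by (subst S[OF that v]) (simp only: distrib_left mult_ac)
    qed
    then have "(\<lambda>n. A (t n) v) = (\<lambda>n. (1 - r (t n)) * y (t n) v + r (t n) * G (A (t n)) v)"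
      using t by auto
    moreover have "(\<lambda>n. (1 - r (t n)) * y (t n) v + r (t n) * G (A (t n)) v)
        \<longlonglongrightarrow> (1 - 1) * y0 v + 1 * G a v"
      by (intro tendsto_intros filterlim_compose[OF r1 tlim] filterlim_compose[OF y[OF v] tlim]
          tendsto_apply at v)
    ultimately show ?thesis using at[OF v] LIMSEQ_unique by fastforce
  qed
  have "((\<lambda>s. A s v) \<longlongrightarrow> a v) (at_right d)" if v: "v \<in> V" for v
  proof (rule tendstoI)
    fix eps :: real assume eps: "0 < eps"
    \<comment> \<open>Four errors of size \<open>h * x v\<close> will be collected; the fifth makes
      the final inequality strict.\<close>
    define h where "h = eps / (5 * x v)"
    have h: "0 < h" using eps x_pos[OF v] by (simp add: h_def)
    have "\<forall>\<^sub>F n in sequentially. \<forall>w\<in>V. dist (A (t n) w) (a w) < h * x w"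
      using fin at h x_pos by (intro eventually_ball_finite) (auto simp: tendsto_iff)
    moreover have ye: "\<forall>\<^sub>F s in at_right d. \<forall>w\<in>V. dist (y s w) (y0 w) < h * x w"
      using fin y h x_pos by (intro eventually_ball_finite) (auto simp: tendsto_iff)
    moreover have "\<forall>\<^sub>F n in sequentially. \<forall>w\<in>V. dist (y (t n) w) (y0 w) < h * x w"
      using filterlim_iff[THEN iffD1, OF tlim] ye by blast
    ultimately have "\<forall>\<^sub>F n in sequentially. (\<forall>w\<in>V. dist (A (t n) w) (a w) < h * x w) \<and>
        (\<forall>w\<in>V. dist (y (t n) w) (y0 w) < h * x w)"
      by (intro eventually_conj)
    then obtain n where n: "\<And>w. w \<in> V \<Longrightarrow> dist (A (t n) w) (a w) < h * x w"
        "\<And>w. w \<in> V \<Longrightarrow> dist (y (t n) w) (y0 w) < h * x w"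
      unfolding eventually_sequentially by blast
    \<comment> \<open>The index \<open>n\<close> is now frozen while \<open>s\<close> varies. The
      resolvent equation at \<open>t n\<close> reads \<open>z - G z = y (t n) - A (t n)\<close>,
      which is within \<open>2 * h * x\<close> of \<open>y0 - a\<close>; this is the approximation
      of \<open>y - a\<close> by a coboundary.\<close>
    define z where "z w = r (t n) * S (t n) w" for w
    have Gz: "G z w = r (t n) * G (S (t n)) w" if "w \<in> V" for w
      using lin[OF that, of "r (t n)" "S (t n)" 0 "S (t n)"] unfolding z_def by simp
    obtain L where L: "\<And>w. w \<in> V \<Longrightarrow> \<bar>z w\<bar> \<le> L * x w"
      using exists_bound by blast
    have "((\<lambda>s. 2 * (1 - r s) * L) \<longlongrightarrow> 2 * (1 - 1) * L) (at_right d)"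
      by (intro tendsto_intros r1)
    then have "\<forall>\<^sub>F s in at_right d. dist (2 * (1 - r s) * L) 0 < h"
      using h by (simp add: tendsto_iff)
    moreover have "\<forall>\<^sub>F s in at_right d. d < s" by (simp add: eventually_at_right_less)
    ultimately show "\<forall>\<^sub>F s in at_right d. dist (A s v) (a v) < eps"
      using ye
    proof eventually_elim
      case (elim s)
      \<comment> \<open>\<open>U\<close> solves the resolvent equation with the small right-hand
        side \<open>f\<close>, and \<open>A s - a\<close> equals
        \<open>(1 - r s) * z - (1 - r s) * U\<close>. The bound \<open>L\<close> on \<open>z\<close>
        does not depend on \<open>s\<close>, so the first term vanishes as \<open>s\<close> tends to
        \<open>d\<close>. The factors \<open>1\<close> and \<open>- 1\<close> match the shape of
        \<open>lin\<close>.\<close>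
      define U where "U w = 1 * z w + 1 * ((- 1) * S s w + (1 / (1 - r s)) * a w)" for w
      define f where "f w = z w - r s * G z w - y s w + a w" for w
      have rs: "0 \<le> r s" "r s < 1" using r elim by auto
      have "U w = f w + r s * G U w" if w: "w \<in> V" for w
      proof -
        define c where "c = 1 / (1 - r s) * a w"
        have c: "c = a w + r s * c"
          using rs by (simp add: c_def field_simps)
        have GU: "G U w = G z w - G (S s) w + c"
          unfolding U_def c_def by (simp only: lin[OF w] Ga[OF w]) simp
        have "U w = z w - S s w + c" by (simp add: U_def c_def)
        also have "\<dots> = z w - (y s w + r s * G (S s) w) + (a w + r s * c)"
          using S[OF elim(2) w] c by simp
        also have "\<dots> = f w + r s * (G z w - G (S s) w + c)"
          unfolding f_def by (simp add: right_diff_distrib distrib_left)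
        finally show ?thesis unfolding GU .
      qed
      moreover have "\<bar>f w\<bar> \<le> ((1 - r s) * L + 3 * h) * x w" if w: "w \<in> V" for w
      proof -
        have "\<bar>G z w\<bar> \<le> L * x w" using apply_bound[of z L w] L w by blast
        then have 1: "(1 - r s) * \<bar>G z w\<bar> \<le> (1 - r s) * (L * x w)"
          using rs by (intro mult_left_mono) auto
        have "z w - G z w = y (t n) w - A (t n) w"
          using S[OF t w, of n] Gz[OF w] unfolding z_def A_def by (simp add: algebra_simps)
        then have "f w = (1 - r s) * G z w + (y (t n) w - y0 w) - (A (t n) w - a w) - (y s w - y0 w)"
          unfolding f_def by (simp add: algebra_simps)
        then have "\<bar>f w\<bar> \<le> (1 - r s) * \<bar>G z w\<bar> + \<bar>y (t n) w - y0 w\<bar> + \<bar>A (t n) w - a w\<bar> + \<bar>y s w - y0 w\<bar>"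
          using rs abs_mult[of "1 - r s" "G z w"] by linarith
        also have "\<dots> \<le> (1 - r s) * (L * x w) + h * x w + h * x w + h * x w"
          using 1 n[OF w] elim(3)[rule_format, OF w] unfolding dist_real_def by linarith
        finally show ?thesis by (simp add: algebra_simps)
      qed
      ultimately have U: "(1 - r s) * \<bar>U v\<bar> \<le> ((1 - r s) * L + 3 * h) * x v"
        using resolvent_bound[OF rs, of U f] v by blast
      have "A s v - a v = (1 - r s) * z v - (1 - r s) * U v"
        using rs unfolding A_def U_def by (simp add: field_simps)
      then have "\<bar>A s v - a v\<bar> \<le> (1 - r s) * \<bar>z v\<bar> + (1 - r s) * \<bar>U v\<bar>"
        using rs abs_triangle_ineq4[of "(1 - r s) * z v" "(1 - r s) * U v"] by (simp add: abs_mult)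
      also have "\<dots> \<le> (1 - r s) * (L * x v) + ((1 - r s) * L + 3 * h) * x v"
        using U L[OF v] rs by (intro add_mono mult_left_mono) auto
      also have "\<dots> = (2 * (1 - r s) * L + 3 * h) * x v" by (simp add: algebra_simps)
      also have "\<dots> \<le> (h + 3 * h) * x v"
        using elim(1) x_pos[OF v] by (intro mult_right_mono) (auto simp: dist_real_def)
      also have "\<dots> < eps" using eps x_pos[OF v] by (simp add: h_def)
      finally show ?case by (simp add: dist_real_def)
    qed
  qed
  then show ?thesis unfolding A_def by blast
qed

end

section \<open>The Perron--Frobenius eigenvector\<close>

definition morphisms_between :: "('a, 'b) kgraph_scheme \<Rightarrow> (nat \<Rightarrow> nat) \<Rightarrow> 'a \<Rightarrow> 'a \<Rightarrow> 'a set" where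
  "morphisms_between \<Lambda> n v w = {\<mu> \<in> mor_of_degree \<Lambda> n. rng \<Lambda> \<mu> = v \<and> src \<Lambda> \<mu> = w}"

lemma adj_conv: "adj \<Lambda> i v w = card (morphisms_between \<Lambda> (unit_degree i) v w)"
  by (simp add: adj_def morphisms_between_def)

lemma unit_degree_Nk: "i \<in> {1..k} \<Longrightarrow> unit_degree i \<in> Nk k"
  by (auto simp: unit_degree_def Nk_def)

section \<open>Spectral radius of a nonnegative matrix with a positive eigenvector\<close>

lemma spectral_radius_eqI:
  fixes A :: "complex mat"
  assumes A: "A \<in> carrier_mat n n" and n: "0 < n"
    and c: "eigenvalue A (complex_of_real c)" "0 \<le> c"
    and le: "\<And>z. eigenvalue A z \<Longrightarrow> norm z \<le> c"
  shows "spectral_radius A = c"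
proof (rule antisym)
  show "spectral_radius A \<le> c"
    using spectral_radius_mem_max(1)[OF A n] le unfolding spectrum_def by auto
  show "c \<le> spectral_radius A"
    using spectral_radius_mem_max(2)[OF A n, of c] c unfolding spectrum_def
    by (force simp: image_iff)
qed

text \<open>Compare an arbitrary complex eigenvector \<open>u\<close> with \<open>x\<close> at an
  index where \<open>norm (u i) / x i\<close> is maximal: the triangle inequality there bounds the
  modulus of its eigenvalue by \<open>c\<close>. This identifies \<open>rho\<close> with the
  eigenvalue of any positive eigenvector.\<close>

lemma spectral_radius_positive_eigenvector:
  fixes B :: "nat \<Rightarrow> nat \<Rightarrow> real" and x :: "nat \<Rightarrow> real"
  assumes n: "0 < n" and B: "\<And>i j. 0 \<le> B i j" and x: "\<And>i. i < n \<Longrightarrow> 0 < x i"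
    and eq: "\<And>i. i < n \<Longrightarrow> (\<Sum>j<n. B i j * x j) = c * x i"
  shows "spectral_radius (Matrix.mat n n (\<lambda>(i, j). complex_of_real (B i j))) = c"
proof -
  define M where "M = Matrix.mat n n (\<lambda>(i, j). complex_of_real (B i j))"
  have M: "M \<in> carrier_mat n n" by (simp add: M_def)
  have mult: "vec_index (M *\<^sub>v u) i = (\<Sum>j<n. B i j * vec_index u j)" if "u \<in> carrier_vec n" "i < n" for u i
    using that by (simp add: M_def mult_mat_vec_def scalar_prod_def lessThan_atLeast0)
  have c0: "0 \<le> c"
  proof -
    have "0 \<le> (\<Sum>j<n. B 0 j * x j)"
      using B x by (intro sum_nonneg mult_nonneg_nonneg) (auto intro: less_imp_le)
    then show ?thesis using eq[OF n] x[OF n] by (simp add: zero_le_mult_iff)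
  qed
  show ?thesis
    unfolding M_def[symmetric]
  proof (rule spectral_radius_eqI[OF M n _ c0])
    define u where "u = Matrix.vec n (\<lambda>i. complex_of_real (x i))"
    have u: "u \<in> carrier_vec n" by (simp add: u_def)
    have "M *\<^sub>v u = complex_of_real c \<cdot>\<^sub>v u"
    proof (rule eq_vecI)
      fix i assume "i < dim_vec (complex_of_real c \<cdot>\<^sub>v u)"
      then have i: "i < n" by (simp add: u_def)
      have "vec_index (M *\<^sub>v u) i = complex_of_real (\<Sum>j<n. B i j * x j)"
        unfolding mult[OF u i] by (simp add: u_def)
      also have "\<dots> = vec_index (complex_of_real c \<cdot>\<^sub>v u) i"
        using i by (simp add: eq u_def)
      finally show "vec_index (M *\<^sub>v u) i = vec_index (complex_of_real c \<cdot>\<^sub>v u) i" .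
    qed (simp add: M_def u_def)
    moreover have "u \<noteq> 0\<^sub>v n"
    proof
      assume "u = 0\<^sub>v n"
      then have "vec_index u 0 = 0" using n by simp
      then show False using x[OF n] n by (simp add: u_def)
    qed
    ultimately show "eigenvalue M (complex_of_real c)"
      unfolding eigenvalue_def eigenvector_def using u M by auto
  next
    fix z assume "eigenvalue M z"
    then obtain u where u: "u \<in> carrier_vec n" "u \<noteq> 0\<^sub>v n" "M *\<^sub>v u = z \<cdot>\<^sub>v u"
      unfolding eigenvalue_def eigenvector_def using M by auto
    define t where "t = Max ((\<lambda>i. norm (vec_index u i) / x i) ` {..<n})"
    have "t \<in> (\<lambda>i. norm (vec_index u i) / x i) ` {..<n}"
      unfolding t_def using n by (intro Max_in) auto
    then obtain i where i: "i < n" "norm (vec_index u i) = t * x i" using x by force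
    have le: "norm (vec_index u j) \<le> t * x j" if "j < n" for j
    proof -
      have "norm (vec_index u j) / x j \<le> t" unfolding t_def using that by (intro Max_ge) auto
      then show ?thesis using x[OF that] by (simp add: divide_le_eq)
    qed
    have "\<exists>j<n. vec_index u j \<noteq> 0"
    proof (rule ccontr)
      assume "\<not> ?thesis"
      then have "u = 0\<^sub>v n" using u(1) by (intro eq_vecI) auto
      with u(2) show False by blast
    qed
    then obtain j where j: "j < n" "vec_index u j \<noteq> 0" by blast
    have "0 < t * x j" using le[OF j(1)] j(2) by (meson less_le_trans zero_less_norm_iff)
    then have t: "0 < t" using x[OF j(1)] by (simp add: zero_less_mult_iff)
    have "norm z * (t * x i) = norm (vec_index (M *\<^sub>v u) i)"
      using i u by (simp add: norm_mult)
    also have "\<dots> \<le> (\<Sum>j<n. norm (B i j * vec_index u j))"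
      unfolding mult[OF u(1) i(1)] by (rule norm_sum)
    also have "\<dots> \<le> (\<Sum>j<n. B i j * (t * x j))"
      using B le by (intro sum_mono) (auto simp: norm_mult intro!: mult_left_mono)
    also have "\<dots> = t * (\<Sum>j<n. B i j * x j)"
      by (simp add: sum_distrib_left mult_ac)
    also have "\<dots> = c * (t * x i)" using eq[OF i(1)] by simp
    finally show "norm z \<le> c" using t x[OF i(1)] by simp
  qed
qed

section \<open>Counting morphisms in a finite k-graph\<close>

context
  fixes \<Lambda> :: "'a kgraph"
  assumes kgraph: "k_graph \<Lambda>" and finite_graph: "finite_kgraph \<Lambda>"
begin

lemma finite_vertices: "finite (vertices \<Lambda>)"
  using finite_graph unfolding finite_kgraph_def vertices_def by (simp add: Nk_def)

lemma finite_morphisms_between: "n \<in> Nk (rank \<Lambda>) \<Longrightarrow> finite (morphisms_between \<Lambda> n v w)"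
  using finite_graph unfolding finite_kgraph_def morphisms_between_def by (auto intro: rev_finite_subset)

lemma category: "small_category \<Lambda>" and degree: "degree_functor \<Lambda>"
  and factorization: "factorization_property \<Lambda>"
  using kgraph by (auto simp: k_graph_def)

lemma src_vertex: "\<mu> \<in> mor \<Lambda> \<Longrightarrow> src \<Lambda> \<mu> \<in> vertices \<Lambda>"
  and rng_vertex: "\<mu> \<in> mor \<Lambda> \<Longrightarrow> rng \<Lambda> \<mu> \<in> vertices \<Lambda>"
  using category degree
  by (auto simp: small_category_def degree_functor_def vertices_def mor_of_degree_def)

lemma factor_unique:
  assumes "\<mu> \<in> mor \<Lambda>" "\<nu> \<in> mor \<Lambda>" "src \<Lambda> \<mu> = rng \<Lambda> \<nu>"
    and "\<mu>' \<in> mor \<Lambda>" "\<nu>' \<in> mor \<Lambda>" "src \<Lambda> \<mu>' = rng \<Lambda> \<nu>'"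
    and "deg \<Lambda> \<mu> = deg \<Lambda> \<mu>'" "deg \<Lambda> \<nu> = deg \<Lambda> \<nu>'" "comp \<Lambda> \<mu> \<nu> = comp \<Lambda> \<mu>' \<nu>'"
  shows "\<mu> = \<mu>' \<and> \<nu> = \<nu>'"
proof -
  have "comp \<Lambda> \<mu> \<nu> \<in> mor \<Lambda>" "deg \<Lambda> (comp \<Lambda> \<mu> \<nu>) = (\<lambda>i. deg \<Lambda> \<mu> i + deg \<Lambda> \<nu> i)"
    "deg \<Lambda> \<mu> \<in> Nk (rank \<Lambda>)" "deg \<Lambda> \<nu> \<in> Nk (rank \<Lambda>)"
    using assms(1-3) category degree by (auto simp: small_category_def degree_functor_def)
  then have "\<exists>!(\<mu>1, \<nu>1). \<mu>1 \<in> mor \<Lambda> \<and> \<nu>1 \<in> mor \<Lambda> \<and> src \<Lambda> \<mu>1 = rng \<Lambda> \<nu>1 \<and>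
      deg \<Lambda> \<mu>1 = deg \<Lambda> \<mu> \<and> deg \<Lambda> \<nu>1 = deg \<Lambda> \<nu> \<and> comp \<Lambda> \<mu> \<nu> = comp \<Lambda> \<mu>1 \<nu>1"
    using factorization unfolding factorization_property_def by blast
  then obtain p where "\<And>\<mu>1 \<nu>1. \<mu>1 \<in> mor \<Lambda> \<Longrightarrow> \<nu>1 \<in> mor \<Lambda> \<Longrightarrow> src \<Lambda> \<mu>1 = rng \<Lambda> \<nu>1 \<Longrightarrow>
      deg \<Lambda> \<mu>1 = deg \<Lambda> \<mu> \<Longrightarrow> deg \<Lambda> \<nu>1 = deg \<Lambda> \<nu> \<Longrightarrow> comp \<Lambda> \<mu> \<nu> = comp \<Lambda> \<mu>1 \<nu>1 \<Longrightarrow>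
      (\<mu>1, \<nu>1) = p"
    by (elim ex1E) auto
  from this[of \<mu> \<nu>] this[of \<mu>' \<nu>'] show ?thesis using assms by auto
qed

text \<open>Vertices are introduced as morphisms of degree \<open>0\<close>. That they are
  identities follows from unique factorization, because \<open>v\<close> is both
  \<open>rng v\<close> followed by \<open>v\<close> and \<open>v\<close> followed by
  \<open>src v\<close>, with all factors of degree \<open>0\<close>.\<close>

lemma vertex_src_rng: "v \<in> vertices \<Lambda> \<Longrightarrow> src \<Lambda> v = v \<and> rng \<Lambda> v = v"
proof -
  assume v: "v \<in> vertices \<Lambda>"
  then have "v \<in> mor \<Lambda>" "deg \<Lambda> v = (\<lambda>_. 0)" by (auto simp: vertices_def mor_of_degree_def)
  moreover have "src \<Lambda> v \<in> mor \<Lambda>" "rng \<Lambda> v \<in> mor \<Lambda>" "comp \<Lambda> (rng \<Lambda> v) v = v" "comp \<Lambda> v (src \<Lambda> v) = v"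
    "deg \<Lambda> (src \<Lambda> v) = (\<lambda>_. 0)" "deg \<Lambda> (rng \<Lambda> v) = (\<lambda>_. 0)"
    "rng \<Lambda> (src \<Lambda> v) = src \<Lambda> v" "src \<Lambda> (rng \<Lambda> v) = rng \<Lambda> v"
    using \<open>v \<in> mor \<Lambda>\<close> category degree by (auto simp: small_category_def degree_functor_def)
  ultimately show ?thesis
    using factor_unique[of "rng \<Lambda> v" v v "src \<Lambda> v"] by auto
qed

lemma morphisms_between_zero:
  assumes "v \<in> vertices \<Lambda>"
  shows "morphisms_between \<Lambda> (\<lambda>_. 0) v w = (if v = w then {v} else {})"
  using vertex_src_rng assms by (auto simp: morphisms_between_def vertices_def)

text \<open>The factorization property in matrix form: composition is a bijection from composable
  pairs of degrees \<open>m\<close> and \<open>n\<close>. Hence the count matrices multiply as the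
  degrees add, and they commute.\<close>

lemma card_morphisms_between_add:
  assumes m: "m \<in> Nk (rank \<Lambda>)" and n: "n \<in> Nk (rank \<Lambda>)"
  shows "card (morphisms_between \<Lambda> (\<lambda>i. m i + n i) v w) =
    (\<Sum>u\<in>vertices \<Lambda>. card (morphisms_between \<Lambda> m v u) * card (morphisms_between \<Lambda> n u w))"
proof -
  let ?P = "SIGMA u:vertices \<Lambda>. morphisms_between \<Lambda> m v u \<times> morphisms_between \<Lambda> n u w"
  have "bij_betw (\<lambda>(u, \<mu>, \<nu>). comp \<Lambda> \<mu> \<nu>) ?P (morphisms_between \<Lambda> (\<lambda>i. m i + n i) v w)"
  proof (rule bij_betwI')
    fix p q assume pq: "p \<in> ?P" "q \<in> ?P"
    obtain u \<mu> \<nu> u' \<mu>' \<nu>' where eqs: "p = (u, \<mu>, \<nu>)" "q = (u', \<mu>', \<nu>')"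
      by (metis prod.exhaust)
    have "\<mu> \<in> mor \<Lambda>" "\<nu> \<in> mor \<Lambda>" "src \<Lambda> \<mu> = u" "rng \<Lambda> \<nu> = u" "deg \<Lambda> \<mu> = m" "deg \<Lambda> \<nu> = n"
      "\<mu>' \<in> mor \<Lambda>" "\<nu>' \<in> mor \<Lambda>" "src \<Lambda> \<mu>' = u'" "rng \<Lambda> \<nu>' = u'" "deg \<Lambda> \<mu>' = m" "deg \<Lambda> \<nu>' = n"
      using pq unfolding eqs by (simp_all add: morphisms_between_def mor_of_degree_def)
    with factor_unique[of \<mu> \<nu> \<mu>' \<nu>'] show "(case p of (u, \<mu>, \<nu>) \<Rightarrow> comp \<Lambda> \<mu> \<nu>) = (case q of (u, \<mu>, \<nu>) \<Rightarrow> comp \<Lambda> \<mu> \<nu>) \<longleftrightarrow> p = q"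
      unfolding eqs by auto
  next
    fix p assume "p \<in> ?P"
    then show "(case p of (u, \<mu>, \<nu>) \<Rightarrow> comp \<Lambda> \<mu> \<nu>) \<in> morphisms_between \<Lambda> (\<lambda>i. m i + n i) v w"
      using category degree
      by (auto simp: morphisms_between_def mor_of_degree_def small_category_def degree_functor_def)
  next
    fix \<kappa> assume \<kappa>: "\<kappa> \<in> morphisms_between \<Lambda> (\<lambda>i. m i + n i) v w"
    then have "\<kappa> \<in> mor \<Lambda>" "deg \<Lambda> \<kappa> = (\<lambda>i. m i + n i)" "rng \<Lambda> \<kappa> = v" "src \<Lambda> \<kappa> = w"
      by (auto simp: morphisms_between_def mor_of_degree_def)
    then obtain \<mu> \<nu> where \<mu>\<nu>: "\<mu> \<in> mor \<Lambda>" "\<nu> \<in> mor \<Lambda>" "src \<Lambda> \<mu> = rng \<Lambda> \<nu>" "deg \<Lambda> \<mu> = m"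
      "deg \<Lambda> \<nu> = n" "\<kappa> = comp \<Lambda> \<mu> \<nu>"
      using factorization m n unfolding factorization_property_def by blast
    moreover have "rng \<Lambda> \<kappa> = rng \<Lambda> \<mu>" "src \<Lambda> \<kappa> = src \<Lambda> \<nu>"
      using \<mu>\<nu> category by (auto simp: small_category_def)
    ultimately have "(src \<Lambda> \<mu>, \<mu>, \<nu>) \<in> ?P"
      using \<open>rng \<Lambda> \<kappa> = v\<close> \<open>src \<Lambda> \<kappa> = w\<close> src_vertex rng_vertex
      by (auto simp: morphisms_between_def mor_of_degree_def)
    then show "\<exists>p\<in>?P. \<kappa> = (case p of (u, \<mu>, \<nu>) \<Rightarrow> comp \<Lambda> \<mu> \<nu>)"
      using \<mu>\<nu>(6) by (intro bexI[of _ "(src \<Lambda> \<mu>, \<mu>, \<nu>)"]) auto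
  qed
  then have "card (morphisms_between \<Lambda> (\<lambda>i. m i + n i) v w) = card ?P"
    by (rule bij_betw_same_card[symmetric])
  also have "\<dots> = (\<Sum>u\<in>vertices \<Lambda>. card (morphisms_between \<Lambda> m v u \<times> morphisms_between \<Lambda> n u w))"
    using finite_morphisms_between m n by (intro card_SigmaI finite_vertices) auto
  finally show ?thesis by (simp add: card_cartesian_product)
qed

lemma rho_eqI:
  assumes ne: "vertices \<Lambda> \<noteq> {}" and x: "\<And>v. v \<in> vertices \<Lambda> \<Longrightarrow> 0 < x v"
    and eq: "\<And>v. v \<in> vertices \<Lambda> \<Longrightarrow> (\<Sum>w\<in>vertices \<Lambda>. real (adj \<Lambda> i v w) * x w) = c * x v"
  shows "rho \<Lambda> i = c"
proof -
  define e where "e = from_nat_into (vertices \<Lambda>)"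
  have e: "bij_betw e {..<card (vertices \<Lambda>)} (vertices \<Lambda>)"
    unfolding e_def using finite_vertices by (rule bij_betw_from_nat_into_finite)
  have "spectral_radius (Matrix.mat (card (vertices \<Lambda>)) (card (vertices \<Lambda>))
      (\<lambda>(a, b). complex_of_real (real (adj \<Lambda> i (e a) (e b))))) = c"
  proof (rule spectral_radius_positive_eigenvector[where x = "x \<circ> e"])
    show "0 < card (vertices \<Lambda>)" using ne finite_vertices by (simp add: card_gt_0_iff)
    fix a assume a: "a < card (vertices \<Lambda>)"
    then have ea: "e a \<in> vertices \<Lambda>" using bij_betwE[OF e] by auto
    show "0 < (x \<circ> e) a" using x[OF ea] by simp
    show "(\<Sum>b<card (vertices \<Lambda>). real (adj \<Lambda> i (e a) (e b)) * (x \<circ> e) b) = c * (x \<circ> e) a"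
      using eq[OF ea] sum.reindex_bij_betw[OF e, of "\<lambda>w. real (adj \<Lambda> i (e a) w) * x w"] by simp
  qed simp
  then show ?thesis by (simp add: rho_def adj_mat_def e_def)
qed

text \<open>By induction on the total degree: splitting off one unit degree \<open>j\<close> writes
  the count matrix as the vertex matrix of colour \<open>j\<close> times the count matrix of a
  smaller degree.\<close>

lemma morphisms_between_eigenvector:
  assumes eq: "\<And>i v. i \<in> {1..rank \<Lambda>} \<Longrightarrow> v \<in> vertices \<Lambda> \<Longrightarrow>
      (\<Sum>w\<in>vertices \<Lambda>. real (adj \<Lambda> i v w) * x w) = c i * x v"
    and n: "n \<in> Nk (rank \<Lambda>)" and v: "v \<in> vertices \<Lambda>"
  shows "(\<Sum>w\<in>vertices \<Lambda>. real (card (morphisms_between \<Lambda> n v w)) * x w)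
    = (\<Prod>i\<in>{1..rank \<Lambda>}. c i ^ n i) * x v"
  using n v
proof (induction "\<Sum>i\<in>{1..rank \<Lambda>}. n i" arbitrary: n v)
  case 0
  then have "n i = 0" for i by (cases "i \<in> {1..rank \<Lambda>}") (auto simp: Nk_def)
  then have n: "n = (\<lambda>_. 0)" by auto
  have "(\<Sum>w\<in>vertices \<Lambda>. real (card (morphisms_between \<Lambda> n v w)) * x w)
      = (\<Sum>w\<in>vertices \<Lambda>. if w = v then x w else 0)"
    unfolding n using 0 by (intro sum.cong) (auto simp: morphisms_between_zero)
  then show ?case using 0 finite_vertices by (simp add: n)
next
  case (Suc d)
  then obtain j where j: "j \<in> {1..rank \<Lambda>}" "n j \<noteq> 0"
    by (metis nat.distinct(1) sum.neutral)
  define m where "m i = (if i = j then n i - 1 else n i)" for i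
  have nm: "n = (\<lambda>i. unit_degree j i + m i)"
    using j by (auto simp: m_def unit_degree_def)
  have m: "m \<in> Nk (rank \<Lambda>)" using Suc.prems by (auto simp: m_def Nk_def)
  have "(\<Sum>i\<in>{1..rank \<Lambda>}. unit_degree j i) = 1"
    using j by (simp add: unit_degree_def)
  then have d: "d = (\<Sum>i\<in>{1..rank \<Lambda>}. m i)"
    using Suc.hyps(2) by (simp add: nm sum.distrib)
  have pr: "(\<Prod>i\<in>{1..rank \<Lambda>}. c i ^ unit_degree j i) = c j"
    using j by (simp add: unit_degree_def if_distrib[of "\<lambda>a. _ ^ a"] cong: if_cong)
  have np: "(\<Prod>i\<in>{1..rank \<Lambda>}. c i ^ n i) = c j * (\<Prod>i\<in>{1..rank \<Lambda>}. c i ^ m i)"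
    by (simp only: nm power_add prod.distrib pr)
  have "(\<Sum>w\<in>vertices \<Lambda>. real (card (morphisms_between \<Lambda> n v w)) * x w)
     = (\<Sum>w\<in>vertices \<Lambda>. \<Sum>u\<in>vertices \<Lambda>. real (adj \<Lambda> j v u) * (real (card (morphisms_between \<Lambda> m u w)) * x w))"
    unfolding nm card_morphisms_between_add[OF unit_degree_Nk[OF j(1)] m] adj_conv
    by (simp add: sum_distrib_right mult.assoc)
  also have "\<dots> = (\<Sum>u\<in>vertices \<Lambda>. real (adj \<Lambda> j v u) *
      (\<Sum>w\<in>vertices \<Lambda>. real (card (morphisms_between \<Lambda> m u w)) * x w))"
    by (subst sum.swap) (simp add: sum_distrib_left)
  also have "\<dots> = (\<Sum>u\<in>vertices \<Lambda>. real (adj \<Lambda> j v u) * ((\<Prod>i\<in>{1..rank \<Lambda>}. c i ^ m i) * x u))"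
    using Suc.hyps(1)[OF d m] by (intro sum.cong) auto
  also have "\<dots> = (\<Prod>i\<in>{1..rank \<Lambda>}. c i ^ m i) * (\<Sum>u\<in>vertices \<Lambda>. real (adj \<Lambda> j v u) * x u)"
    by (simp add: sum_distrib_left mult_ac)
  also have "\<dots> = (\<Prod>i\<in>{1..rank \<Lambda>}. c i ^ n i) * x v"
    unfolding eq[OF j(1) Suc.prems(2)] np by simp
  finally show ?case .
qed

text \<open>Choose one morphism for every pair of vertices and let \<open>D\<close> collect their
  degrees. A single degree need not connect all pairs, as a directed cycle shows.\<close>

lemma finite_connecting_degrees:
  assumes sc: "strongly_connected \<Lambda>"
  obtains D where "finite D" "D \<subseteq> Nk (rank \<Lambda>)"
    "\<And>v w. v \<in> vertices \<Lambda> \<Longrightarrow> w \<in> vertices \<Lambda> \<Longrightarrow>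
      0 < (\<Sum>n\<in>D. real (card (morphisms_between \<Lambda> n v w)))"
proof -
  have "\<exists>\<mu>\<in>mor \<Lambda>. rng \<Lambda> \<mu> = v \<and> src \<Lambda> \<mu> = w" if "v \<in> vertices \<Lambda>" "w \<in> vertices \<Lambda>" for v w
    using sc that unfolding strongly_connected_def by blast
  then obtain f where f: "\<And>v w. v \<in> vertices \<Lambda> \<Longrightarrow> w \<in> vertices \<Lambda> \<Longrightarrow>
      f v w \<in> mor \<Lambda> \<and> rng \<Lambda> (f v w) = v \<and> src \<Lambda> (f v w) = w"
    by metis
  define D where "D = (\<lambda>(v, w). deg \<Lambda> (f v w)) ` (vertices \<Lambda> \<times> vertices \<Lambda>)"
  have D: "finite D" "D \<subseteq> Nk (rank \<Lambda>)"
    using f degree finite_vertices by (auto simp: D_def degree_functor_def)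
  have "0 < (\<Sum>n\<in>D. real (card (morphisms_between \<Lambda> n v w)))"
    if vw: "v \<in> vertices \<Lambda>" "w \<in> vertices \<Lambda>" for v w
  proof (rule sum_pos2[OF D(1)])
    show mem: "deg \<Lambda> (f v w) \<in> D" using vw by (auto simp: D_def)
    have "f v w \<in> morphisms_between \<Lambda> (deg \<Lambda> (f v w)) v w"
      using f[OF vw] by (simp add: morphisms_between_def mor_of_degree_def)
    then show "0 < real (card (morphisms_between \<Lambda> (deg \<Lambda> (f v w)) v w))"
      using finite_morphisms_between mem D(2) by (auto simp: card_gt_0_iff)
  qed simp
  then show thesis using that D by blast
qed

text \<open>Existence: \<open>M\<close> commutes with each vertex matrix, so that matrix maps the
  eigenvector \<open>x\<close> of \<open>M\<close> to a vector with the same eigenvalue, which is a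
  multiple of \<open>x\<close>; the multiple is the spectral radius by \<open>rho_eqI\<close>.
  Uniqueness: every candidate is an eigenvector of \<open>M\<close> for one and the same eigenvalue,
  and the normalisation fixes the scale.\<close>

lemma is_pf_eigenvector_pf_eigenvector:
  assumes sc: "strongly_connected \<Lambda>" and ne: "vertices \<Lambda> \<noteq> {}"
  shows "is_pf_eigenvector \<Lambda> (pf_eigenvector \<Lambda>)"
proof -
  let ?V = "vertices \<Lambda>"
  obtain D where D: "finite D" "D \<subseteq> Nk (rank \<Lambda>)"
    and M0: "\<And>v w. v \<in> ?V \<Longrightarrow> w \<in> ?V \<Longrightarrow> 0 < (\<Sum>n\<in>D. real (card (morphisms_between \<Lambda> n v w)))"
    using finite_connecting_degrees[OF sc] by metis
  define M where "M v w = (\<Sum>n\<in>D. real (card (morphisms_between \<Lambda> n v w)))" for v w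
  have M: "0 < M v w" if "v \<in> ?V" "w \<in> ?V" for v w
    using M0[OF that] by (simp add: M_def)
  have apply_M: "(\<Sum>w\<in>?V. M v w * z w) = (\<Sum>n\<in>D. \<Sum>w\<in>?V. real (card (morphisms_between \<Lambda> n v w)) * z w)"
    for z v
    unfolding M_def by (subst sum.swap) (simp add: sum_distrib_right)
  obtain x l where x: "\<And>v. v \<in> ?V \<Longrightarrow> 0 < x v"
    and Mx: "\<And>v. v \<in> ?V \<Longrightarrow> (\<Sum>w\<in>?V. M v w * x w) = l * x v"
    using positive_matrix_eigenvector[of ?V M] finite_vertices ne M by blast
  \<comment> \<open>For each \<open>n \<in> D\<close> both products count the morphisms of degree
    \<open>unit_degree i + n\<close> from \<open>w\<close> to \<open>v\<close>.\<close>
  have commute: "(\<Sum>u\<in>?V. real (adj \<Lambda> i v u) * M u w) = (\<Sum>u\<in>?V. M v u * real (adj \<Lambda> i u w))"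
    if i: "i \<in> {1..rank \<Lambda>}" for i v w
  proof -
    have "(\<Sum>u\<in>?V. adj \<Lambda> i v u * card (morphisms_between \<Lambda> n u w))
        = (\<Sum>u\<in>?V. card (morphisms_between \<Lambda> n v u) * adj \<Lambda> i u w)" if "n \<in> D" for n
    proof -
      have n: "n \<in> Nk (rank \<Lambda>)" using D that by auto
      show ?thesis
        unfolding adj_conv
        using card_morphisms_between_add[OF unit_degree_Nk[OF i] n, of v w]
          card_morphisms_between_add[OF n unit_degree_Nk[OF i], of v w]
        by (simp add: add.commute)
    qed
    then have "(\<Sum>n\<in>D. \<Sum>u\<in>?V. real (adj \<Lambda> i v u * card (morphisms_between \<Lambda> n u w)))
        = (\<Sum>n\<in>D. \<Sum>u\<in>?V. real (card (morphisms_between \<Lambda> n v u) * adj \<Lambda> i u w))"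
      unfolding of_nat_sum[symmetric] by simp
    then show ?thesis
      unfolding M_def by (simp add: sum_distrib_left sum_distrib_right sum.swap[of _ ?V D])
  qed
  have "\<exists>c. \<forall>v\<in>?V. (\<Sum>w\<in>?V. real (adj \<Lambda> i v w) * x w) = c * x v" if i: "i \<in> {1..rank \<Lambda>}" for i
  proof -
    define y where "y v = (\<Sum>w\<in>?V. real (adj \<Lambda> i v w) * x w)" for v
    have "(\<Sum>w\<in>?V. M v w * y w) = l * y v" if v: "v \<in> ?V" for v
    proof -
      have "(\<Sum>u\<in>?V. M v u * y u) = (\<Sum>w\<in>?V. (\<Sum>u\<in>?V. M v u * real (adj \<Lambda> i u w)) * x w)"
        unfolding y_def sum_distrib_left sum_distrib_right
        by (subst sum.swap) (simp add: mult.assoc)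
      also have "\<dots> = (\<Sum>w\<in>?V. (\<Sum>u\<in>?V. real (adj \<Lambda> i v u) * M u w) * x w)"
        by (simp add: commute[OF i])
      also have "\<dots> = (\<Sum>u\<in>?V. real (adj \<Lambda> i v u) * (\<Sum>w\<in>?V. M u w * x w))"
        unfolding sum_distrib_left sum_distrib_right
        by (subst sum.swap) (simp add: mult.assoc)
      also have "\<dots> = (\<Sum>u\<in>?V. l * (real (adj \<Lambda> i v u) * x u))"
        by (intro sum.cong) (simp_all add: Mx)
      also have "\<dots> = l * y v"
        unfolding y_def sum_distrib_left ..
      finally show ?thesis .
    qed
    then obtain c where "\<And>v. v \<in> ?V \<Longrightarrow> y v = c * x v"
      using positive_matrix_eigenvector_unique[of ?V M x l y] finite_vertices ne M x Mx by blast
    then show ?thesis unfolding y_def by blast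
  qed
  then have ex: "\<exists>c. \<forall>v\<in>?V. (\<Sum>w\<in>?V. real (adj \<Lambda> i v w) * x w) = c * x v"
    if "i \<in> {1..rank \<Lambda>}" for i
    using that by blast
  have eq: "(\<Sum>w\<in>?V. real (adj \<Lambda> i v w) * x w) = rho \<Lambda> i * x v"
    if iv: "i \<in> {1..rank \<Lambda>}" "v \<in> ?V" for i v
  proof -
    obtain c where c: "\<And>v. v \<in> ?V \<Longrightarrow> (\<Sum>w\<in>?V. real (adj \<Lambda> i v w) * x w) = c * x v"
      using ex[OF iv(1)] by blast
    have "rho \<Lambda> i = c" by (rule rho_eqI[OF ne x c])
    then show ?thesis using c[OF iv(2)] by simp
  qed
  define e where "e v = (if v \<in> ?V then x v / sum x ?V else 0)" for v
  have sx: "0 < sum x ?V" using finite_vertices ne x by (intro sum_pos) auto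
  have e: "is_pf_eigenvector \<Lambda> e"
    unfolding is_pf_eigenvector_def
  proof (intro conjI allI ballI impI)
    show "sum e ?V = 1" using sx by (simp add: e_def flip: sum_divide_distrib)
    fix i v assume iv: "i \<in> {1..rank \<Lambda>}" "v \<in> ?V"
    have "(\<Sum>w\<in>?V. real (adj \<Lambda> i v w) * e w) = (\<Sum>w\<in>?V. real (adj \<Lambda> i v w) * x w) / sum x ?V"
      by (simp add: e_def sum_divide_distrib)
    then show "(\<Sum>w\<in>?V. real (adj \<Lambda> i v w) * e w) = rho \<Lambda> i * e v"
      using iv by (simp add: eq e_def)
  qed (use x sx in \<open>auto simp: e_def\<close>)
  show ?thesis
    unfolding pf_eigenvector_def
  proof (rule theI[of _ e])
    fix y assume y: "is_pf_eigenvector \<Lambda> y"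
    \<comment> \<open>This value involves only \<open>rho\<close> and \<open>D\<close>, not the
      candidate, so it is a common eigenvalue of \<open>M\<close> for \<open>e\<close> and
      \<open>y\<close>.\<close>
    define k where "k = (\<Sum>n\<in>D. \<Prod>i\<in>{1..rank \<Lambda>}. rho \<Lambda> i ^ n i)"
    have Mz: "(\<Sum>w\<in>?V. M v w * z w) = k * z v" if z: "is_pf_eigenvector \<Lambda> z" and v: "v \<in> ?V" for z v
    proof -
      have "(\<Sum>w\<in>?V. real (card (morphisms_between \<Lambda> n v w)) * z w)
          = (\<Prod>i\<in>{1..rank \<Lambda>}. rho \<Lambda> i ^ n i) * z v" if "n \<in> D" for n
        using z D that v unfolding is_pf_eigenvector_def
        by (intro morphisms_between_eigenvector) auto
      then show ?thesis unfolding apply_M k_def by (simp add: sum_distrib_right)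
    qed
    have e_pos: "0 < e v" if "v \<in> ?V" for v
      using e that unfolding is_pf_eigenvector_def by blast
    obtain c where c: "\<And>v. v \<in> ?V \<Longrightarrow> y v = c * e v"
      using positive_matrix_eigenvector_unique[of ?V M e k y] finite_vertices ne M e_pos Mz[OF e] Mz[OF y]
      by blast
    have "1 = sum y ?V" using y by (simp add: is_pf_eigenvector_def)
    also have "\<dots> = c * sum e ?V" by (simp add: c sum_distrib_left)
    also have "\<dots> = c" using e by (simp add: is_pf_eigenvector_def)
    finally have "y v = e v" if "v \<in> ?V" for v using c[OF that] by simp
    moreover have "y v = e v" if "v \<notin> ?V" for v
      using that y e unfolding is_pf_eigenvector_def by metis
    ultimately show "y = e" by blast
  qed (rule e)
qed

end

section \<open>Sums over the extensions of a finite path\<close>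

lemma finite_paths_iff:
  "(v, es) \<in> finite_paths \<Lambda> \<longleftrightarrow> v \<in> bvertices \<Lambda> 0 \<and> (\<forall>i<length es. es ! i \<in> bedges \<Lambda> (i + 1)) \<and>
     (es \<noteq> [] \<longrightarrow> brange (hd es) = v) \<and> (\<forall>i. i + 1 < length es \<longrightarrow> bsource (es ! i) = brange (es ! (i + 1)))"
  by (simp add: finite_paths_def)

lemma bedges_iff:
  "e \<in> bedges \<Lambda> n \<longleftrightarrow>
     (\<exists>p q j. e = (n, p, q, j) \<and> p \<in> vertices \<Lambda> \<and> q \<in> vertices \<Lambda> \<and> j < adj \<Lambda> (colour \<Lambda> n) p q)"
  by (auto simp: bedges_def)

lemma bsource_bedges: "e \<in> bedges \<Lambda> n \<Longrightarrow> bsource e \<in> bvertices \<Lambda> n"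
  by (auto simp: bedges_def bvertices_def)

definition end_vertex :: "'a bpath \<Rightarrow> 'a" where
  "end_vertex \<eta> = snd (path_source \<eta>)"

lemma path_source_bvertices:
  assumes "\<eta> \<in> finite_paths \<Lambda>"
  shows "path_source \<eta> \<in> bvertices \<Lambda> (path_length \<eta>)"
proof (cases "snd \<eta> = []")
  case True
  then show ?thesis
    using assms by (cases \<eta>) (simp add: finite_paths_iff path_source_def path_length_def)
next
  case False
  then have "last (snd \<eta>) \<in> bedges \<Lambda> (length (snd \<eta>))"
    using assms by (cases \<eta>) (auto simp: finite_paths_iff last_conv_nth dest!: spec[of _ "length (snd \<eta>) - 1"])
  then show ?thesis
    using False by (simp add: path_source_def path_length_def bsource_bedges)
qed

lemma path_source_conv:
  assumes "\<eta> \<in> finite_paths \<Lambda>"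
  shows "path_source \<eta> = (path_length \<eta>, end_vertex \<eta>)" "end_vertex \<eta> \<in> vertices \<Lambda>"
  using path_source_bvertices[OF assms] by (auto simp: end_vertex_def bvertices_def)

definition append_edge :: "'a bpath \<Rightarrow> 'a bedge \<Rightarrow> 'a bpath" where
  "append_edge \<eta> e = (fst \<eta>, snd \<eta> @ [e])"

definition next_edges :: "('a, 'b) kgraph_scheme \<Rightarrow> 'a bpath \<Rightarrow> 'a bedge set" where
  "next_edges \<Lambda> \<eta> = {e \<in> bedges \<Lambda> (path_length \<eta> + 1). brange e = path_source \<eta>}"

lemma path_length_append_edge [simp]: "path_length (append_edge \<eta> e) = Suc (path_length \<eta>)"
  by (simp add: append_edge_def path_length_def)

lemma path_source_append_edge [simp]: "path_source (append_edge \<eta> e) = bsource e"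
  by (simp add: append_edge_def path_source_def)

lemma append_edge_inject [simp]: "append_edge \<eta> e = append_edge \<eta>' e' \<longleftrightarrow> \<eta> = \<eta>' \<and> e = e'"
  by (auto simp: append_edge_def prod_eq_iff)

lemma append_edge_finite_paths_iff:
  "append_edge \<eta> e \<in> finite_paths \<Lambda> \<longleftrightarrow> \<eta> \<in> finite_paths \<Lambda> \<and> e \<in> next_edges \<Lambda> \<eta>"
proof -
  obtain v es where \<eta>: "\<eta> = (v, es)" by (cases \<eta>)
  show ?thesis
  proof (cases "es = []")
    case True
    then show ?thesis
      by (auto simp: \<eta> append_edge_def finite_paths_iff next_edges_def path_length_def path_source_def)
  next
    case False
    then obtain n where n: "length es = Suc n" by (cases es) auto
    have 1: "(\<forall>i<length (es @ [e]). (es @ [e]) ! i \<in> bedges \<Lambda> (i + 1)) \<longleftrightarrow>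
        (\<forall>i<length es. es ! i \<in> bedges \<Lambda> (i + 1)) \<and> e \<in> bedges \<Lambda> (length es + 1)"
      by (auto simp: nth_append less_Suc_eq)
    have 2: "(\<forall>i. i + 1 < length (es @ [e]) \<longrightarrow> bsource ((es @ [e]) ! i) = brange ((es @ [e]) ! (i + 1))) \<longleftrightarrow>
        (\<forall>i. i + 1 < length es \<longrightarrow> bsource (es ! i) = brange (es ! (i + 1))) \<and> bsource (last es) = brange e"
      using n False by (auto simp: nth_append less_Suc_eq last_conv_nth)
    show ?thesis
      using False unfolding \<eta> append_edge_def finite_paths_iff fst_conv snd_conv 1 2 next_edges_def
      by (auto simp: path_length_def path_source_def)
  qed
qed

lemma next_edges_image:
  assumes "\<eta> \<in> finite_paths \<Lambda>"
  shows "next_edges \<Lambda> \<eta> = (\<lambda>(q, j). (Suc (path_length \<eta>), end_vertex \<eta>, q, j)) `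
    (SIGMA q:vertices \<Lambda>. {..<adj \<Lambda> (colour \<Lambda> (Suc (path_length \<eta>))) (end_vertex \<eta>) q})"
  using path_source_conv[OF assms] by (auto simp: next_edges_def bedges_def image_iff)

text \<open>Parallel edges differ only in their number \<open>j\<close>, so each target
  \<open>w\<close> is met \<open>adj\<close> times with the same value.\<close>

lemma sum_next_edges:
  fixes g :: "'a \<Rightarrow> real"
  assumes "finite (vertices \<Lambda>)" "\<eta> \<in> finite_paths \<Lambda>"
  shows "(\<Sum>e\<in>next_edges \<Lambda> \<eta>. g (end_vertex (append_edge \<eta> e))) =
    (\<Sum>w\<in>vertices \<Lambda>. real (adj \<Lambda> (colour \<Lambda> (Suc (path_length \<eta>))) (end_vertex \<eta>) w) * g w)"
proof -
  have "inj_on (\<lambda>(q, j). (Suc (path_length \<eta>), end_vertex \<eta>, q, j)) A" for A :: "('a \<times> nat) set"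
    by (auto simp: inj_on_def)
  then have "(\<Sum>e\<in>next_edges \<Lambda> \<eta>. g (end_vertex (append_edge \<eta> e))) =
    (\<Sum>(q, j)\<in>(SIGMA q:vertices \<Lambda>. {..<adj \<Lambda> (colour \<Lambda> (Suc (path_length \<eta>))) (end_vertex \<eta>) q}). g q)"
    unfolding next_edges_image[OF assms(2)]
    by (subst sum.reindex) (auto simp: end_vertex_def intro!: sum.cong)
  also have "\<dots> = (\<Sum>w\<in>vertices \<Lambda>. real (adj \<Lambda> (colour \<Lambda> (Suc (path_length \<eta>))) (end_vertex \<eta>) w) * g w)"
    using assms(1) by (subst sum.Sigma[symmetric]) auto
  finally show ?thesis .
qed

lemma finite_next_edges:
  assumes "finite (vertices \<Lambda>)" "\<eta> \<in> finite_paths \<Lambda>"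
  shows "finite (next_edges \<Lambda> \<eta>)"
  unfolding next_edges_image[OF assms(2)] using assms(1) by (intro finite_imageI finite_SigmaI) auto

definition extensions_by :: "('a, 'b) kgraph_scheme \<Rightarrow> 'a bpath \<Rightarrow> nat \<Rightarrow> 'a bpath set" where
  "extensions_by \<Lambda> \<gamma> l = {\<eta> \<in> extensions \<Lambda> \<gamma>. path_length \<eta> = path_length \<gamma> + l}"

lemma extensions_by_0:
  assumes "\<gamma> \<in> finite_paths \<Lambda>"
  shows "extensions_by \<Lambda> \<gamma> 0 = {\<gamma>}"
  using assms by (auto simp: extensions_by_def extensions_def path_length_def prod_eq_iff prefix_def)

lemma finite_paths_take:
  assumes "(v, es @ fs) \<in> finite_paths \<Lambda>"
  shows "(v, es) \<in> finite_paths \<Lambda>"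
  using assms
proof (induction fs rule: rev_induct)
  case (snoc f fs)
  then show ?case
    using append_edge_finite_paths_iff[of "(v, es @ fs)" f \<Lambda>] by (simp add: append_edge_def)
qed simp

text \<open>The split is at the first added edge, not the last, to agree with the recursion of
  \<open>transfer\<close>, where \<open>f\<close> stays at the far end.\<close>

lemma extensions_by_Suc:
  assumes "\<gamma> \<in> finite_paths \<Lambda>"
  shows "extensions_by \<Lambda> \<gamma> (Suc l) = (\<Union>e\<in>next_edges \<Lambda> \<gamma>. extensions_by \<Lambda> (append_edge \<gamma> e) l)"
proof (intro equalityI subsetI)
  fix \<eta> assume "\<eta> \<in> extensions_by \<Lambda> \<gamma> (Suc l)"
  then have \<eta>: "\<eta> \<in> finite_paths \<Lambda>" "fst \<eta> = fst \<gamma>" "prefix (snd \<gamma>) (snd \<eta>)"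
    "path_length \<eta> = path_length \<gamma> + Suc l"
    by (auto simp: extensions_by_def extensions_def)
  then obtain fs where fs: "snd \<eta> = snd \<gamma> @ fs" "length fs = Suc l"
    by (auto simp: prefix_def path_length_def)
  then obtain e gs where gs: "fs = e # gs" by (cases fs) auto
  have "(fst \<gamma>, (snd \<gamma> @ [e]) @ gs) \<in> finite_paths \<Lambda>"
    using \<eta> fs gs by (metis append.assoc append_Cons append_Nil prod.collapse)
  then have "append_edge \<gamma> e \<in> finite_paths \<Lambda>"
    unfolding append_edge_def by (rule finite_paths_take)
  then have "e \<in> next_edges \<Lambda> \<gamma>" by (simp add: append_edge_finite_paths_iff)
  moreover have "\<eta> \<in> extensions_by \<Lambda> (append_edge \<gamma> e) l"
    using \<eta> fs gs by (simp add: extensions_by_def extensions_def) (simp add: append_edge_def)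
  ultimately show "\<eta> \<in> (\<Union>e\<in>next_edges \<Lambda> \<gamma>. extensions_by \<Lambda> (append_edge \<gamma> e) l)" by blast
next
  fix \<eta> assume "\<eta> \<in> (\<Union>e\<in>next_edges \<Lambda> \<gamma>. extensions_by \<Lambda> (append_edge \<gamma> e) l)"
  then show "\<eta> \<in> extensions_by \<Lambda> \<gamma> (Suc l)"
    by (auto simp: extensions_by_def extensions_def append_edge_def path_length_def prefix_def)
qed

lemma extensions_by_disjoint:
  "e \<noteq> e' \<Longrightarrow> extensions_by \<Lambda> (append_edge \<gamma> e) l \<inter> extensions_by \<Lambda> (append_edge \<gamma> e') l' = {}"
  by (auto simp: extensions_by_def extensions_def append_edge_def prefix_def)

lemma finite_extensions_by:
  assumes "finite (vertices \<Lambda>)" "\<gamma> \<in> finite_paths \<Lambda>"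
  shows "finite (extensions_by \<Lambda> \<gamma> l)"
  using assms(2)
proof (induction l arbitrary: \<gamma>)
  case (Suc l)
  then show ?case
    using finite_next_edges[OF assms(1)]
    by (simp add: extensions_by_Suc append_edge_finite_paths_iff)
qed (simp add: extensions_by_0)

lemma extensions_conv: "extensions \<Lambda> \<gamma> = (\<Union>l. extensions_by \<Lambda> \<gamma> l)"
  by (auto simp: extensions_by_def extensions_def path_length_def prefix_def)

lemma finite_paths_conv:
  "finite_paths \<Lambda> = (\<Union>v\<in>vertices \<Lambda>. extensions \<Lambda> ((0, v), []))"
  by (auto simp: extensions_def finite_paths_def bvertices_def)

lemma vertex_path: "v \<in> vertices \<Lambda> \<Longrightarrow> ((0, v), []) \<in> finite_paths \<Lambda>"
  by (simp add: finite_paths_iff bvertices_def)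

lemma vertex_path_simps [simp]:
  "path_length ((0, v), []) = 0" "end_vertex ((0, v), []) = v"
  by (simp_all add: path_length_def end_vertex_def path_source_def)

text \<open>The product of the vertex matrices of the levels \<open>m + 1\<close>, ...,
  \<open>m + l\<close>, applied to \<open>f\<close>.\<close>

primrec transfer :: "('a, 'b) kgraph_scheme \<Rightarrow> nat \<Rightarrow> nat \<Rightarrow> ('a \<Rightarrow> real) \<Rightarrow> 'a \<Rightarrow> real" where
  "transfer \<Lambda> 0 m f v = f v"
| "transfer \<Lambda> (Suc l) m f v =
     (\<Sum>w\<in>vertices \<Lambda>. real (adj \<Lambda> (colour \<Lambda> (Suc m)) v w) * transfer \<Lambda> l (Suc m) f w)"

lemma sum_extensions_by:
  assumes "finite (vertices \<Lambda>)" "\<gamma> \<in> finite_paths \<Lambda>"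
  shows "(\<Sum>\<eta>\<in>extensions_by \<Lambda> \<gamma> l. f (end_vertex \<eta>)) = transfer \<Lambda> l (path_length \<gamma>) f (end_vertex \<gamma>)"
  using assms(2)
proof (induction l arbitrary: \<gamma>)
  case 0
  then show ?case by (simp add: extensions_by_0)
next
  case (Suc l)
  have "(\<Sum>\<eta>\<in>extensions_by \<Lambda> \<gamma> (Suc l). f (end_vertex \<eta>)) =
    (\<Sum>e\<in>next_edges \<Lambda> \<gamma>. \<Sum>\<eta>\<in>extensions_by \<Lambda> (append_edge \<gamma> e) l. f (end_vertex \<eta>))"
    unfolding extensions_by_Suc[OF Suc.prems]
    using finite_next_edges[OF assms(1)] finite_extensions_by[OF assms(1)] Suc.prems
    by (intro sum.UNION_disjoint) (simp_all add: append_edge_finite_paths_iff extensions_by_disjoint)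
  also have "\<dots> = (\<Sum>e\<in>next_edges \<Lambda> \<gamma>. transfer \<Lambda> l (Suc (path_length \<gamma>)) f (end_vertex (append_edge \<gamma> e)))"
    using Suc.prems by (intro sum.cong refl) (simp add: Suc.IH append_edge_finite_paths_iff)
  finally show ?case
    by (simp add: sum_next_edges[OF assms(1) Suc.prems])
qed

lemma transfer_linear:
  "transfer \<Lambda> l m (\<lambda>w. a * f w + b * g w) v = a * transfer \<Lambda> l m f v + b * transfer \<Lambda> l m g v"
proof (induction l arbitrary: m v)
  case (Suc l)
  show ?case
    unfolding transfer.simps Suc.IH sum_distrib_left sum.distrib[symmetric]
    by (intro sum.cong refl) (simp only: distrib_left mult.left_commute)
qed simp

lemma transfer_nonneg:
  "(\<And>w. w \<in> vertices \<Lambda> \<Longrightarrow> 0 \<le> f w) \<Longrightarrow> v \<in> vertices \<Lambda> \<Longrightarrow> 0 \<le> transfer \<Lambda> l m f v"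
  by (induction l arbitrary: m v) (auto intro!: sum_nonneg mult_nonneg_nonneg)

lemma transfer_add:
  "transfer \<Lambda> (l + l') m f v = transfer \<Lambda> l m (transfer \<Lambda> l' (m + l) f) v"
  by (induction l arbitrary: m v) simp_all

lemma transfer_cong:
  "(\<And>w. w \<in> vertices \<Lambda> \<Longrightarrow> f w = g w) \<Longrightarrow> v \<in> vertices \<Lambda> \<Longrightarrow> transfer \<Lambda> l m f v = transfer \<Lambda> l m g v"
  by (induction l arbitrary: m v) simp_all

lemma colour_add_rank: "colour \<Lambda> (Suc (m + rank \<Lambda>)) = colour \<Lambda> (Suc m)"
  by (simp add: colour_def)

lemma transfer_add_rank: "transfer \<Lambda> l (m + rank \<Lambda>) f v = transfer \<Lambda> l m f v"
proof (induction l arbitrary: m v)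
  case (Suc l)
  then show ?case using Suc.IH[of "Suc m"] by (simp add: colour_add_rank)
qed simp

lemma transfer_sums:
  assumes "\<And>w. w \<in> vertices \<Lambda> \<Longrightarrow> (\<lambda>n. f n w) sums F w" "v \<in> vertices \<Lambda>"
  shows "(\<lambda>n. transfer \<Lambda> l m (f n) v) sums transfer \<Lambda> l m F v"
  using assms(2)
  by (induction l arbitrary: m v) (simp_all add: assms(1) sums_sum sums_mult)

lemma transfer_tendsto:
  assumes "\<And>w. w \<in> vertices \<Lambda> \<Longrightarrow> ((\<lambda>n. f n w) \<longlongrightarrow> g w) F" "v \<in> vertices \<Lambda>"
  shows "((\<lambda>n. transfer \<Lambda> l m (f n) v) \<longlongrightarrow> transfer \<Lambda> l m g v) F"
  using assms(2)
  by (induction l arbitrary: m v) (auto simp: assms(1) intro!: tendsto_intros)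

definition level_rho :: "('a, 'b) kgraph_scheme \<Rightarrow> nat \<Rightarrow> real" where
  "level_rho \<Lambda> n = (\<Prod>i\<in>{1..n}. rho \<Lambda> (colour \<Lambda> i))"

lemma level_rho_Suc: "level_rho \<Lambda> (Suc n) = level_rho \<Lambda> n * rho \<Lambda> (colour \<Lambda> (Suc n))"
  by (simp add: level_rho_def)

text \<open>Among the first \<open>n\<close> levels the colours up to
  \<open>n mod rank \<Lambda>\<close> occur once more than the others. In the induction the quotient
  grows exactly when a period is completed.\<close>

lemma level_rho_conv:
  assumes "1 \<le> rank \<Lambda>"
  shows "(\<Prod>i\<in>{1..n mod rank \<Lambda>}. rho \<Lambda> i ^ (n div rank \<Lambda> + 1)) *
    (\<Prod>i\<in>{n mod rank \<Lambda> + 1..rank \<Lambda>}. rho \<Lambda> i ^ (n div rank \<Lambda>)) = level_rho \<Lambda> n"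
proof (induction n)
  case 0
  then show ?case by (simp add: level_rho_def)
next
  case (Suc n)
  define k where "k = rank \<Lambda>"
  have k: "1 \<le> k" using assms by (simp add: k_def)
  define q t where "q = n div k" and "t = n mod k"
  have t: "t < k" using k by (simp add: t_def)
  have col: "colour \<Lambda> (Suc n) = Suc t" by (simp add: colour_def t_def k_def)
  have IH: "level_rho \<Lambda> n = (\<Prod>i\<in>{1..t}. rho \<Lambda> i ^ (q + 1)) * (\<Prod>i\<in>{t + 1..k}. rho \<Lambda> i ^ q)"
    using Suc.IH by (simp add: k_def q_def t_def)
  have split: "(\<Prod>i\<in>{t + 1..k}. rho \<Lambda> i ^ q) = rho \<Lambda> (Suc t) ^ q * (\<Prod>i\<in>{Suc t + 1..k}. rho \<Lambda> i ^ q)"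
    using t by (simp add: prod.atLeast_Suc_atMost)
  have eq: "level_rho \<Lambda> (Suc n) =
      (\<Prod>i\<in>{1..Suc t}. rho \<Lambda> i ^ (q + 1)) * (\<Prod>i\<in>{Suc t + 1..k}. rho \<Lambda> i ^ q)"
    unfolding level_rho_Suc IH split col by simp
  show ?case
  proof (cases "Suc t = k")
    case True
    then have "Suc n mod k = 0" "Suc n div k = Suc q"
      using k by (simp_all add: mod_Suc div_Suc t_def q_def)
    then show ?thesis unfolding eq k_def[symmetric] using True by simp
  next
    case False
    then have "Suc n mod k = Suc t" "Suc n div k = q"
      using t k by (simp_all add: mod_Suc div_Suc t_def q_def)
    then show ?thesis unfolding eq k_def[symmetric] by simp
  qed
qed

lemma weight_conv:
  "1 \<le> rank \<Lambda> \<Longrightarrow> weight \<Lambda> \<delta> \<eta> =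
    level_rho \<Lambda> (path_length \<eta>) powr (- 1 / \<delta>) * pf_eigenvector \<Lambda> (end_vertex \<eta>)"
  by (simp only: weight_def Let_def level_rho_conv end_vertex_def)

lemma level_rho_add_rank:
  "level_rho \<Lambda> (n + rank \<Lambda>) = level_rho \<Lambda> (rank \<Lambda>) * level_rho \<Lambda> n"
proof (induction n)
  case (Suc n)
  then show ?case by (simp add: level_rho_Suc colour_add_rank)
qed (simp add: level_rho_def)

lemma level_rho_rank: "level_rho \<Lambda> (rank \<Lambda>) = (\<Prod>i\<in>{1..rank \<Lambda>}. rho \<Lambda> i)"
  unfolding level_rho_def by (intro prod.cong) (auto simp: colour_def)

text \<open>The partial sums satisfy \<open>S_N \<le> S_k + r * S_N\<close>, hence are bounded by
  \<open>S_k / (1 - r)\<close>.\<close>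

lemma summable_geometric_period:
  fixes u :: "nat \<Rightarrow> real"
  assumes nonneg: "\<And>n. 0 \<le> u n" and per: "\<And>n. u (n + k) = r * u n" and r: "0 \<le> r" "r < 1"
  shows "summable u"
proof (rule summableI_nonneg_bounded[OF nonneg])
  fix N
  have "(\<Sum>i<N. u i) \<le> (\<Sum>i<N + k. u i)"
    using nonneg by (intro sum_mono2) auto
  also have "\<dots> = (\<Sum>i<k. u i) + (\<Sum>i<N. u (i + k))"
    by (induction N) (simp_all add: add_ac)
  also have "\<dots> = (\<Sum>i<k. u i) + r * (\<Sum>i<N. u i)"
    by (simp add: per sum_distrib_left)
  finally have "(1 - r) * (\<Sum>i<N. u i) \<le> (\<Sum>i<k. u i)" by (simp add: algebra_simps)
  then show "(\<Sum>i<N. u i) \<le> (\<Sum>i<k. u i) / (1 - r)"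
    using r by (simp add: le_divide_eq mult.commute)
qed

text \<open>A disjoint union is a \<open>Sigma\<close> set seen through the injective map
  \<open>snd\<close>; nonnegativity makes the double family summable.\<close>

lemma has_sum_UN_nonneg:
  fixes f :: "'b \<Rightarrow> real"
  assumes "\<And>i. i \<in> I \<Longrightarrow> (f has_sum g i) (B i)" and "(g has_sum S) I"
    and "\<And>i j. i \<in> I \<Longrightarrow> j \<in> I \<Longrightarrow> i \<noteq> j \<Longrightarrow> B i \<inter> B j = {}"
    and "\<And>i b. i \<in> I \<Longrightarrow> b \<in> B i \<Longrightarrow> 0 \<le> f b"
  shows "(f has_sum S) (\<Union>i\<in>I. B i)"
proof -
  have "((\<lambda>(i, b). f b) has_sum S) (Sigma I B)"
  proof (rule has_sum_SigmaI)
    show "(\<lambda>(i, b). f b) summable_on Sigma I B"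
      by (rule summable_on_SigmaI[where g = g]) (use assms in \<open>auto intro: has_sum_imp_summable\<close>)
  qed (use assms in auto)
  moreover have "inj_on snd (Sigma I B)"
    using assms(3) by (fastforce simp: inj_on_def)
  moreover have "snd ` Sigma I B = (\<Union>i\<in>I. B i)" by force
  ultimately show ?thesis
    using has_sum_reindex[of snd "Sigma I B" f S] by (simp add: o_def case_prod_unfold)
qed

section \<open>Asymptotics at the abscissa of convergence\<close>

text \<open>The interface between geometry and analysis: what the asymptotics draw from the diameter
  condition and from the factorization property is recorded in these assumptions.\<close>

locale expanding_diagram =
  fixes \<Lambda> :: "('a, 'b) kgraph_scheme" and \<delta> :: real
  assumes rank_pos: "1 \<le> rank \<Lambda>" and finite_V: "finite (vertices \<Lambda>)" and V_nonempty: "vertices \<Lambda> \<noteq> {}"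
    and \<delta>_pos: "0 < \<delta>"
    and pf: "is_pf_eigenvector \<Lambda> (pf_eigenvector \<Lambda>)"
    and rho_pos: "\<And>i. i \<in> {1..rank \<Lambda>} \<Longrightarrow> 0 < rho \<Lambda> i"
    and rho_prod: "1 < (\<Prod>i\<in>{1..rank \<Lambda>}. rho \<Lambda> i)"
    and cylinder_nonempty: "\<And>\<eta>. \<eta> \<in> finite_paths \<Lambda> \<Longrightarrow> cylinder \<Lambda> \<eta> \<noteq> {}"
begin

abbreviation "V \<equiv> vertices \<Lambda>"
abbreviation "x \<equiv> pf_eigenvector \<Lambda>"
abbreviation "P \<equiv> level_rho \<Lambda>"
abbreviation "k \<equiv> rank \<Lambda>"

definition "R = P k"

lemma x_pos: "v \<in> V \<Longrightarrow> 0 < x v"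
  using pf by (simp add: is_pf_eigenvector_def)

lemma x_le_1: "v \<in> V \<Longrightarrow> x v \<le> 1"
  using pf member_le_sum[of v V x] x_pos finite_V
  by (force simp: is_pf_eigenvector_def less_imp_le)

lemma colour_range: "colour \<Lambda> n \<in> {1..k}"
  using rank_pos by (auto simp: colour_def Suc_le_eq)

lemma eigen: "v \<in> V \<Longrightarrow> (\<Sum>w\<in>V. real (adj \<Lambda> (colour \<Lambda> n) v w) * x w) = rho \<Lambda> (colour \<Lambda> n) * x v"
  using pf colour_range[of n] unfolding is_pf_eigenvector_def by blast

lemma P_pos: "0 < P n"
  unfolding level_rho_def using rho_pos colour_range by (intro prod_pos) blast

lemma R_gt_1: "1 < R"
  using rho_prod by (simp add: R_def level_rho_rank)

lemma P_add: "P (n + k) = R * P n"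
  unfolding R_def by (rule level_rho_add_rank)

lemma transfer_x: "v \<in> V \<Longrightarrow> P m * transfer \<Lambda> l m x v = P (m + l) * x v"
proof (induction l arbitrary: m v)
  case (Suc l)
  have rho: "0 < rho \<Lambda> (colour \<Lambda> (Suc m))" using rho_pos colour_range by blast
  \<comment> \<open>The extra factor turns \<open>P m\<close> into \<open>P (Suc m)\<close>, as the
    induction hypothesis requires; it is cancelled at the end.\<close>
  have "rho \<Lambda> (colour \<Lambda> (Suc m)) * (P m * transfer \<Lambda> (Suc l) m x v)
      = (\<Sum>w\<in>V. real (adj \<Lambda> (colour \<Lambda> (Suc m)) v w) * (P (Suc m) * transfer \<Lambda> l (Suc m) x w))"
    by (simp add: sum_distrib_left level_rho_Suc mult_ac)
  also have "\<dots> = P (m + Suc l) * (\<Sum>w\<in>V. real (adj \<Lambda> (colour \<Lambda> (Suc m)) v w) * x w)"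
    by (simp add: Suc.IH sum_distrib_left mult_ac)
  also have "\<dots> = rho \<Lambda> (colour \<Lambda> (Suc m)) * (P (m + Suc l) * x v)"
    unfolding eigen[OF Suc.prems] by simp
  finally show ?case using rho by simp
qed simp

text \<open>\<open>level_sum s m v l\<close> is the contribution to the sum over the extensions of a path of length \<open>m\<close>
  with source \<open>v\<close> of the extensions by \<open>l\<close> edges.\<close>

definition level_sum :: "real \<Rightarrow> nat \<Rightarrow> 'a \<Rightarrow> nat \<Rightarrow> real" where
  "level_sum s m v l = P (m + l) powr (- s / \<delta>) * transfer \<Lambda> l m (\<lambda>w. x w powr s) v"

definition ext_sum :: "real \<Rightarrow> nat \<Rightarrow> 'a \<Rightarrow> real" where
  "ext_sum s m v = (\<Sum>l. level_sum s m v l)"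

definition ratio :: "real \<Rightarrow> real" where
  "ratio s = R powr (1 - s / \<delta>)"

lemma ratio_bounds: "\<delta> < s \<Longrightarrow> 0 \<le> ratio s \<and> ratio s < 1"
  using R_gt_1 \<delta>_pos by (simp add: ratio_def powr_less_one)

lemma ratio_conv: "ratio s = R * R powr (- s / \<delta>)"
  using R_gt_1 powr_add[of R 1 "- s / \<delta>"] by (simp add: ratio_def)

lemma ratio_tendsto: "(ratio \<longlongrightarrow> 1) (at_right \<delta>)"
proof -
  have "((\<lambda>s. R powr (1 - s / \<delta>)) \<longlongrightarrow> R powr (1 - \<delta> / \<delta>)) (at_right \<delta>)"
    using R_gt_1 \<delta>_pos by (intro tendsto_intros) auto
  then show ?thesis unfolding ratio_def using \<delta>_pos R_gt_1 by simp
qed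

lemma positive_operator_transfer: "positive_operator V x (\<lambda>f v. transfer \<Lambda> k m f v / R)"
proof
  fix v assume v: "v \<in> V"
  have "P m * transfer \<Lambda> k m x v = P m * (R * x v)"
    by (simp add: transfer_x[OF v] P_add)
  then show "transfer \<Lambda> k m x v / R = x v"
    using P_pos[of m] R_gt_1 by simp
next
  fix f :: "'a \<Rightarrow> real" and v assume "\<And>w. w \<in> V \<Longrightarrow> 0 \<le> f w" "v \<in> V"
  then show "0 \<le> transfer \<Lambda> k m f v / R"
    using R_gt_1 by (intro divide_nonneg_pos transfer_nonneg) auto
qed (simp_all add: finite_V V_nonempty x_pos transfer_linear add_divide_distrib)

lemma level_sum_nonneg: "v \<in> V \<Longrightarrow> 0 \<le> level_sum s m v l"
  unfolding level_sum_def by (intro mult_nonneg_nonneg transfer_nonneg) auto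

text \<open>Replacing \<open>x powr s\<close> by a multiple \<open>C * x\<close> above it makes the
  level sums computable, since \<open>x\<close> is an eigenvector at every level. The majorant
  \<open>u\<close> is geometric along each period with factor \<open>ratio s < 1\<close>.\<close>

lemma level_sum_summable:
  assumes s: "\<delta> < s" and v: "v \<in> V"
  shows "summable (level_sum s m v)"
proof -
  interpret positive_operator V x "\<lambda>f v. transfer \<Lambda> k m f v / R"
    by (rule positive_operator_transfer)
  obtain C where C: "\<And>w. w \<in> V \<Longrightarrow> \<bar>x w powr s\<bar> \<le> C * x w"
    using exists_bound[of "\<lambda>w. x w powr s"] by blast
  define u where "u l = C * x v / P m * P (m + l) powr (1 - s / \<delta>)" for l
  have C0: "0 \<le> C" using C[OF v] x_pos[OF v] by (metis abs_ge_zero order_trans zero_le_mult_iff not_less)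
  have u: "summable u"
  proof (rule summable_geometric_period[where k = k and r = "ratio s"])
    show "0 \<le> u l" for l
      unfolding u_def using C0 x_pos[OF v] P_pos[of m] by simp
    show "u (l + k) = ratio s * u l" for l
      using P_add[of "m + l"] R_gt_1 P_pos[of "m + l"]
      by (simp add: u_def ratio_def powr_mult add.assoc)
  qed (use ratio_bounds[OF s] in auto)
  have le: "level_sum s m v l \<le> u l" for l
  proof -
    have "0 \<le> transfer \<Lambda> l m (\<lambda>w. C * x w + (- 1) * x w powr s) v"
      using C by (intro transfer_nonneg v) simp
    then have "transfer \<Lambda> l m (\<lambda>w. x w powr s) v \<le> C * transfer \<Lambda> l m x v"
      unfolding transfer_linear by simp
    also have "transfer \<Lambda> l m x v = P (m + l) * x v / P m"
      using transfer_x[OF v, of m l] P_pos[of m] by (simp add: field_simps)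
    finally have "level_sum s m v l \<le> P (m + l) powr (- s / \<delta>) * (C * (P (m + l) * x v / P m))"
      unfolding level_sum_def by (intro mult_left_mono) auto
    also have "\<dots> = C * x v / P m * (P (m + l) * P (m + l) powr (- s / \<delta>))" by simp
    also have "P (m + l) * P (m + l) powr (- s / \<delta>) = P (m + l) powr (1 - s / \<delta>)"
      using P_pos[of "m + l"] powr_add[of "P (m + l)" 1 "- s / \<delta>"] by simp
    finally show ?thesis unfolding u_def .
  qed
  show ?thesis
    using level_sum_nonneg[OF v] le by (intro summable_comparison_test'[OF u]) simp
qed

lemma level_sum_sums: "\<delta> < s \<Longrightarrow> v \<in> V \<Longrightarrow> level_sum s m v sums ext_sum s m v"
  unfolding ext_sum_def using level_sum_summable by blast

lemma weight_powr:
  assumes "\<eta> \<in> finite_paths \<Lambda>"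
  shows "weight \<Lambda> \<delta> \<eta> powr s = P (path_length \<eta>) powr (- s / \<delta>) * x (end_vertex \<eta>) powr s"
  using x_pos[OF path_source_conv(2)[OF assms]] by (simp add: weight_conv[OF rank_pos] powr_mult powr_powr)

lemma has_sum_extensions:
  assumes s: "\<delta> < s" and \<gamma>: "\<gamma> \<in> finite_paths \<Lambda>"
  shows "((\<lambda>\<eta>. weight \<Lambda> \<delta> \<eta> powr s) has_sum ext_sum s (path_length \<gamma>) (end_vertex \<gamma>)) (extensions \<Lambda> \<gamma>)"
  unfolding extensions_conv
proof (rule has_sum_UN_nonneg)
  note v = path_source_conv(2)[OF \<gamma>]
  show "(level_sum s (path_length \<gamma>) (end_vertex \<gamma>) has_sum ext_sum s (path_length \<gamma>) (end_vertex \<gamma>)) UNIV"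
    using level_sum_sums[OF s v] level_sum_nonneg[OF v] by (rule sums_nonneg_imp_has_sum)
  show "((\<lambda>\<eta>. weight \<Lambda> \<delta> \<eta> powr s) has_sum level_sum s (path_length \<gamma>) (end_vertex \<gamma>) l)
      (extensions_by \<Lambda> \<gamma> l)" for l
  proof (rule has_sum_finiteI[OF finite_extensions_by[OF finite_V \<gamma>]])
    have "(\<Sum>\<eta>\<in>extensions_by \<Lambda> \<gamma> l. weight \<Lambda> \<delta> \<eta> powr s) =
        (\<Sum>\<eta>\<in>extensions_by \<Lambda> \<gamma> l. P (path_length \<gamma> + l) powr (- s / \<delta>) * x (end_vertex \<eta>) powr s)"
      by (intro sum.cong refl) (simp add: extensions_by_def extensions_def weight_powr)
    then show "level_sum s (path_length \<gamma>) (end_vertex \<gamma>) l = (\<Sum>\<eta>\<in>extensions_by \<Lambda> \<gamma> l. weight \<Lambda> \<delta> \<eta> powr s)"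
      unfolding level_sum_def sum_extensions_by[OF finite_V \<gamma>, symmetric] by (simp add: sum_distrib_left)
  qed
qed (auto simp: extensions_by_def)

lemma has_sum_zeta:
  assumes s: "\<delta> < s"
  shows "((\<lambda>\<eta>. weight \<Lambda> \<delta> \<eta> powr s) has_sum (\<Sum>v\<in>V. ext_sum s 0 v)) (finite_paths \<Lambda>)"
  unfolding finite_paths_conv
proof (rule has_sum_UN_nonneg)
  show "((\<lambda>v. ext_sum s 0 v) has_sum (\<Sum>v\<in>V. ext_sum s 0 v)) V"
    using finite_V by simp
  show "((\<lambda>\<eta>. weight \<Lambda> \<delta> \<eta> powr s) has_sum ext_sum s 0 v) (extensions \<Lambda> ((0, v), []))" if "v \<in> V" for v
    using has_sum_extensions[OF s vertex_path[OF that]] by simp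
qed (auto simp: extensions_def)

text \<open>The transfer operator is a finite sum and passes through the series;
  \<open>transfer_add\<close> identifies the tail. The case \<open>n = k\<close> gives the resolvent
  equation, the case \<open>n = 1\<close> the additivity of the limits.\<close>

lemma ext_sum_split:
  assumes s: "\<delta> < s" and v: "v \<in> V"
  shows "ext_sum s m v = (\<Sum>l<n. level_sum s m v l) + transfer \<Lambda> n m (ext_sum s (m + n)) v"
proof -
  have "(\<lambda>l. transfer \<Lambda> n m (\<lambda>w. level_sum s (m + n) w l) v) sums transfer \<Lambda> n m (ext_sum s (m + n)) v"
    by (rule transfer_sums[OF level_sum_sums[OF s] v])
  moreover have "transfer \<Lambda> n m (\<lambda>w. level_sum s (m + n) w l) v = level_sum s m v (l + n)" for l
  proof -
    \<comment> \<open>The summand \<open>0 * x w\<close> only brings a scalar multiple into the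
      shape of \<open>transfer_linear\<close>.\<close>
    have "transfer \<Lambda> n m (\<lambda>w. level_sum s (m + n) w l) v
        = transfer \<Lambda> n m (\<lambda>w. P (m + n + l) powr (- s / \<delta>) * transfer \<Lambda> l (m + n) (\<lambda>w. x w powr s) w
            + 0 * x w) v"
      by (simp add: level_sum_def)
    also have "\<dots> = P (m + n + l) powr (- s / \<delta>) * transfer \<Lambda> (n + l) m (\<lambda>w. x w powr s) v"
      unfolding transfer_linear transfer_add by simp
    finally show ?thesis by (simp add: level_sum_def add_ac)
  qed
  ultimately have "(\<lambda>l. level_sum s m v (l + n)) sums transfer \<Lambda> n m (ext_sum s (m + n)) v" by simp
  then show ?thesis
    using suminf_split_initial_segment[OF level_sum_summable[OF s v], of m n]
    by (simp add: ext_sum_def sums_iff)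
qed

lemma ext_sum_add_rank:
  assumes s: "\<delta> < s" and v: "v \<in> V"
  shows "ext_sum s (m + k) v = R powr (- s / \<delta>) * ext_sum s m v"
proof -
  have "level_sum s (m + k) v l = R powr (- s / \<delta>) * level_sum s m v l" for l
    using P_add[of "m + l"] R_gt_1 P_pos[of "m + l"]
    by (simp add: level_sum_def transfer_add_rank powr_mult add_ac)
  then have "level_sum s (m + k) v sums (R powr (- s / \<delta>) * ext_sum s m v)"
    using sums_mult[OF level_sum_sums[OF s v]] by presburger
  then show ?thesis using level_sum_sums[OF s v] sums_unique2 by blast
qed

text \<open>A full period restores the colours and rescales every weight by
  \<open>R powr (- s / \<delta>)\<close>, so beyond the first \<open>k\<close> levels the same
  function \<open>ext_sum s m\<close> reappears. Normalising the transfer operator by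
  \<open>R\<close> leaves the factor \<open>ratio s\<close>.\<close>

lemma ext_sum_resolvent:
  assumes s: "\<delta> < s" and v: "v \<in> V"
  shows "ext_sum s m v = (\<Sum>l<k. level_sum s m v l) + ratio s * (transfer \<Lambda> k m (ext_sum s m) v / R)"
proof -
  have "transfer \<Lambda> k m (ext_sum s (m + k)) v
      = transfer \<Lambda> k m (\<lambda>w. R powr (- s / \<delta>) * ext_sum s m w + 0 * x w) v"
    using ext_sum_add_rank[OF s] by (intro transfer_cong v) simp
  also have "\<dots> = R powr (- s / \<delta>) * transfer \<Lambda> k m (ext_sum s m) v"
    unfolding transfer_linear by simp
  also have "\<dots> = ratio s * (transfer \<Lambda> k m (ext_sum s m) v / R)"
    using R_gt_1 by (simp add: ratio_conv)
  finally show ?thesis using ext_sum_split[OF s v, of m k] by simp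
qed

lemma level_sum_tendsto:
  assumes v: "v \<in> V"
  shows "((\<lambda>s. level_sum s m v l) \<longlongrightarrow> level_sum \<delta> m v l) (at_right \<delta>)"
  unfolding level_sum_def
proof (intro tendsto_mult transfer_tendsto v)
  show "((\<lambda>s. P (m + l) powr (- s / \<delta>)) \<longlongrightarrow> P (m + l) powr (- \<delta> / \<delta>)) (at_right \<delta>)"
    using P_pos[of "m + l"] \<delta>_pos by (intro tendsto_intros) auto
  show "((\<lambda>s. x w powr s) \<longlongrightarrow> x w powr \<delta>) (at_right \<delta>)" if "w \<in> V" for w
    using x_pos[OF that] by (intro tendsto_intros) auto
qed

lemma ext_sum_convergent:
  "\<exists>a. \<forall>v\<in>V. ((\<lambda>s. (1 - ratio s) * ext_sum s m v) \<longlongrightarrow> a v) (at_right \<delta>)"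
proof -
  interpret positive_operator V x "\<lambda>f v. transfer \<Lambda> k m f v / R"
    by (rule positive_operator_transfer)
  show ?thesis
    by (rule resolvent_convergent[OF ratio_bounds ratio_tendsto ext_sum_resolvent])
       (auto intro!: tendsto_sum level_sum_tendsto)
qed

text \<open>Up to the common factor \<open>ln R / \<delta>\<close>, the limit of
  \<open>(s - \<delta>) * ext_sum s m v\<close>; the factor cancels in the quotient by the zeta
  function.\<close>

definition residue :: "nat \<Rightarrow> 'a \<Rightarrow> real" where
  "residue m = (SOME a. \<forall>v\<in>V. ((\<lambda>s. (1 - ratio s) * ext_sum s m v) \<longlongrightarrow> a v) (at_right \<delta>))"

lemma residue_tendsto:
  "v \<in> V \<Longrightarrow> ((\<lambda>s. (1 - ratio s) * ext_sum s m v) \<longlongrightarrow> residue m v) (at_right \<delta>)"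
  using someI_ex[OF ext_sum_convergent[of m]] unfolding residue_def by blast

text \<open>These values add up to the limit of the normalised zeta function, so their positivity
  permits the division. The minimum principle gives it, with \<open>c * x\<close> as a lower bound
  for the inhomogeneous term.\<close>

lemma residue_0_pos:
  assumes v: "v \<in> V"
  shows "0 < residue 0 v"
proof -
  interpret positive_operator V x "\<lambda>f v. transfer \<Lambda> k 0 f v / R"
    by (rule positive_operator_transfer)
  \<comment> \<open>As \<open>x w \<le> 1\<close>, for \<open>s < \<delta> + 1\<close> one has
    \<open>x w powr s \<ge> x w powr \<delta> * x w \<ge> c * x w\<close>, with \<open>c\<close>
    independent of \<open>s\<close>.\<close>
  define c where "c = Min ((\<lambda>w. x w powr \<delta>) ` V)"
  have "c \<in> (\<lambda>w. x w powr \<delta>) ` V"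
    unfolding c_def using finite_V V_nonempty by (intro Min_in) auto
  then have c: "0 < c" using x_pos by force
  have cle: "c * x w \<le> x w powr s" if "w \<in> V" "s < \<delta> + 1" for w s
  proof -
    have "c * x w \<le> x w powr \<delta> * x w"
      unfolding c_def using finite_V that x_pos[OF that(1)] by (intro mult_right_mono Min_le) auto
    also have "\<dots> = x w powr (\<delta> + 1)" using x_pos[OF that(1)] by (simp add: powr_add)
    also have "\<dots> \<le> x w powr s"
      using that x_pos[OF that(1)] x_le_1[OF that(1)] by (intro powr_mono') auto
    finally show ?thesis .
  qed
  have "c * x v \<le> (1 - ratio s) * ext_sum s 0 v" if s: "\<delta> < s" "s < \<delta> + 1" for s
  proof -
    have r: "0 \<le> ratio s" "ratio s < 1" using ratio_bounds[OF s(1)] by auto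
    \<comment> \<open>\<open>d * x\<close> solves the resolvent equation with right-hand side
      \<open>c * x\<close> and is to lie below \<open>ext_sum s 0\<close>.\<close>
    define d where "d = c / (1 - ratio s)"
    have d: "d = c + ratio s * d"
      using r by (simp add: d_def field_simps)
    have "0 \<le> 1 * ext_sum s 0 v + (- d) * x v"
    proof (rule resolvent_nonneg[OF r _ _ v])
      fix w assume w: "w \<in> V"
      show "0 \<le> (\<Sum>l<k. level_sum s 0 w l) - c * x w"
      proof -
        have "c * x w \<le> level_sum s 0 w 0"
          using cle[OF w s(2)] by (simp add: level_sum_def level_rho_def)
        also have "\<dots> \<le> (\<Sum>l<k. level_sum s 0 w l)"
          using rank_pos level_sum_nonneg[OF w] by (intro member_le_sum) auto
        finally show ?thesis by simp
      qed
      have "1 * ext_sum s 0 w + (- d) * x w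
          = ext_sum s 0 w - d * x w" by simp
      also have "\<dots> = (\<Sum>l<k. level_sum s 0 w l) + ratio s * (transfer \<Lambda> k 0 (ext_sum s 0) w / R)
          - (c + ratio s * d) * x w"
        by (subst ext_sum_resolvent[OF s(1) w, of 0], subst d) simp
      also have "\<dots> = (\<Sum>l<k. level_sum s 0 w l) - c * x w
          + ratio s * (1 * (transfer \<Lambda> k 0 (ext_sum s 0) w / R) + (- d) * x w)"
        by (simp only: distrib_left distrib_right)
      finally show "1 * ext_sum s 0 w + (- d) * x w = (\<Sum>l<k. level_sum s 0 w l) - c * x w
          + ratio s * (transfer \<Lambda> k 0 (\<lambda>w. 1 * ext_sum s 0 w + (- d) * x w) w / R)"
        by (simp only: lin[OF w] fix_x[OF w])
    qed
    then show ?thesis using r by (simp add: d_def field_simps)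
  qed
  then have "\<forall>\<^sub>F s in at_right \<delta>. c * x v \<le> (1 - ratio s) * ext_sum s 0 v"
    unfolding eventually_at_right_field by (intro exI[of _ "\<delta> + 1"]) auto
  then have "c * x v \<le> residue 0 v"
    by (intro tendsto_lowerbound[OF residue_tendsto[OF v]]) auto
  then show ?thesis using c x_pos[OF v] by (meson less_le_trans mult_pos_pos)
qed

lemma residue_nonneg: "v \<in> V \<Longrightarrow> 0 \<le> residue m v"
proof (rule tendsto_lowerbound[OF residue_tendsto])
  assume v: "v \<in> V"
  have "0 \<le> (1 - ratio s) * ext_sum s m v" if "\<delta> < s" for s
    using ratio_bounds[OF that] level_sum_nonneg[OF v] level_sum_summable[OF that v]
    unfolding ext_sum_def by (intro mult_nonneg_nonneg suminf_nonneg) auto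
  then show "\<forall>\<^sub>F s in at_right \<delta>. 0 \<le> (1 - ratio s) * ext_sum s m v"
    unfolding eventually_at_right_field by (intro exI[of _ "\<delta> + 1"]) auto
qed auto

lemma residue_recursion:
  assumes v: "v \<in> V"
  shows "residue m v = (\<Sum>w\<in>V. real (adj \<Lambda> (colour \<Lambda> (Suc m)) v w) * residue (Suc m) w)"
proof (rule tendsto_unique[OF _ residue_tendsto[OF v]])
  have "((\<lambda>s. (1 - ratio s) * level_sum s m v 0 +
      (\<Sum>w\<in>V. real (adj \<Lambda> (colour \<Lambda> (Suc m)) v w) * ((1 - ratio s) * ext_sum s (Suc m) w)))
    \<longlongrightarrow> (1 - 1) * level_sum \<delta> m v 0 +
      (\<Sum>w\<in>V. real (adj \<Lambda> (colour \<Lambda> (Suc m)) v w) * residue (Suc m) w)) (at_right \<delta>)"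
    by (intro tendsto_intros ratio_tendsto level_sum_tendsto residue_tendsto v)
  moreover have "\<forall>\<^sub>F s in at_right \<delta>. (1 - ratio s) * level_sum s m v 0 +
      (\<Sum>w\<in>V. real (adj \<Lambda> (colour \<Lambda> (Suc m)) v w) * ((1 - ratio s) * ext_sum s (Suc m) w))
      = (1 - ratio s) * ext_sum s m v"
    unfolding eventually_at_right_field
  proof (intro exI[of _ "\<delta> + 1"] conjI allI impI)
    fix s assume "\<delta> < s"
    then show "(1 - ratio s) * level_sum s m v 0 +
      (\<Sum>w\<in>V. real (adj \<Lambda> (colour \<Lambda> (Suc m)) v w) * ((1 - ratio s) * ext_sum s (Suc m) w))
      = (1 - ratio s) * ext_sum s m v"
      using ext_sum_split[OF _ v, of s m 1] by (simp add: distrib_left sum_distrib_left mult.left_commute)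
  qed simp
  ultimately show "((\<lambda>s. (1 - ratio s) * ext_sum s m v) \<longlongrightarrow>
      (\<Sum>w\<in>V. real (adj \<Lambda> (colour \<Lambda> (Suc m)) v w) * residue (Suc m) w)) (at_right \<delta>)"
    using Lim_transform_eventually by force
qed simp

definition path_mass :: "'a bpath \<Rightarrow> real" where
  "path_mass \<gamma> = residue (path_length \<gamma>) (end_vertex \<gamma>) / (\<Sum>v\<in>V. residue 0 v)"

lemma residue_sum_pos: "0 < (\<Sum>v\<in>V. residue 0 v)"
  using finite_V V_nonempty residue_0_pos by (intro sum_pos) auto

lemma path_mass_nonneg: "\<gamma> \<in> finite_paths \<Lambda> \<Longrightarrow> 0 \<le> path_mass \<gamma>"
  unfolding path_mass_def using residue_nonneg[OF path_source_conv(2)] residue_sum_pos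
  by (intro divide_nonneg_pos)

lemma path_mass_next_edges:
  assumes "\<gamma> \<in> finite_paths \<Lambda>"
  shows "(\<Sum>e\<in>next_edges \<Lambda> \<gamma>. path_mass (append_edge \<gamma> e)) = path_mass \<gamma>"
proof -
  have "(\<Sum>e\<in>next_edges \<Lambda> \<gamma>. residue (Suc (path_length \<gamma>)) (end_vertex (append_edge \<gamma> e)))
      = residue (path_length \<gamma>) (end_vertex \<gamma>)"
    unfolding sum_next_edges[OF finite_V assms]
    by (rule residue_recursion[OF path_source_conv(2)[OF assms], symmetric])
  then show ?thesis by (simp add: path_mass_def flip: sum_divide_distrib)
qed

lemma path_mass_tendsto:
  assumes \<gamma>: "\<gamma> \<in> finite_paths \<Lambda>"
  shows "((\<lambda>s. (\<Sum>\<^sub>\<infinity>\<eta>\<in>extensions \<Lambda> \<gamma>. weight \<Lambda> \<delta> \<eta> powr s) / zeta \<Lambda> \<delta> s) \<longlongrightarrow> path_mass \<gamma>) (at_right \<delta>)"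
proof -
  \<comment> \<open>Numerator and denominator are multiplied by \<open>1 - ratio s\<close>, nonzero
    for \<open>s > \<delta>\<close>, so that both have finite limits and the denominator a positive
    one.\<close>
  have "((\<lambda>s. (1 - ratio s) * ext_sum s (path_length \<gamma>) (end_vertex \<gamma>) / (\<Sum>v\<in>V. (1 - ratio s) * ext_sum s 0 v))
      \<longlongrightarrow> path_mass \<gamma>) (at_right \<delta>)"
    unfolding path_mass_def using residue_sum_pos path_source_conv(2)[OF \<gamma>]
    by (intro tendsto_divide tendsto_sum residue_tendsto) auto
  moreover have "\<forall>\<^sub>F s in at_right \<delta>.
      (1 - ratio s) * ext_sum s (path_length \<gamma>) (end_vertex \<gamma>) / (\<Sum>v\<in>V. (1 - ratio s) * ext_sum s 0 v)
      = (\<Sum>\<^sub>\<infinity>\<eta>\<in>extensions \<Lambda> \<gamma>. weight \<Lambda> \<delta> \<eta> powr s) / zeta \<Lambda> \<delta> s"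
    unfolding eventually_at_right_field
  proof (intro exI[of _ "\<delta> + 1"] conjI allI impI)
    fix s assume s: "\<delta> < s"
    show "(1 - ratio s) * ext_sum s (path_length \<gamma>) (end_vertex \<gamma>) / (\<Sum>v\<in>V. (1 - ratio s) * ext_sum s 0 v)
      = (\<Sum>\<^sub>\<infinity>\<eta>\<in>extensions \<Lambda> \<gamma>. weight \<Lambda> \<delta> \<eta> powr s) / zeta \<Lambda> \<delta> s"
      using ratio_bounds[OF s] infsumI[OF has_sum_extensions[OF s \<gamma>]] infsumI[OF has_sum_zeta[OF s]]
      by (simp add: zeta_def flip: sum_distrib_left)
  qed simp
  ultimately show ?thesis by (rule Lim_transform_eventually)
qed

end

section \<open>The measure of an additive function on finite paths\<close>

definition path_prefix :: "nat \<Rightarrow> (nat \<Rightarrow> 'a bedge) \<Rightarrow> 'a bpath" where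
  "path_prefix n x = (brange (x 1), map (\<lambda>i. x (i + 1)) [0..<n])"

lemma path_length_prefix [simp]: "path_length (path_prefix n x) = n"
  by (simp add: path_prefix_def path_length_def)

lemma infinite_paths_bedges: "x \<in> infinite_paths \<Lambda> \<Longrightarrow> 1 \<le> n \<Longrightarrow> x n \<in> bedges \<Lambda> n"
  by (auto simp: infinite_paths_def PiE_iff)

lemma path_prefix_finite_paths:
  assumes "x \<in> infinite_paths \<Lambda>"
  shows "path_prefix n x \<in> finite_paths \<Lambda>"
proof -
  have "x 1 \<in> bedges \<Lambda> 1" using assms by (rule infinite_paths_bedges) simp
  then have "brange (x 1) \<in> bvertices \<Lambda> 0" by (auto simp: bedges_def bvertices_def)
  moreover have "bsource (x (Suc i)) = brange (x (Suc (Suc i)))" for i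
    using assms by (auto simp: infinite_paths_def)
  ultimately show ?thesis
    using infinite_paths_bedges[OF assms]
    by (auto simp: path_prefix_def finite_paths_iff hd_map)
qed

text \<open>Cylinders become fibres of \<open>path_prefix\<close>, which reduces statements about
  them to equality of prefixes.\<close>

lemma cylinder_iff:
  "x \<in> cylinder \<Lambda> \<eta> \<longleftrightarrow> x \<in> infinite_paths \<Lambda> \<and> path_prefix (path_length \<eta>) x = \<eta>"
proof -
  obtain v es where \<eta>: "\<eta> = (v, es)" by (cases \<eta>)
  have "map (\<lambda>i. x (i + 1)) [0..<length es] = map (\<lambda>i. es ! i) [0..<length es] \<longleftrightarrow>
      (\<forall>i<length es. x (i + 1) = es ! i)"
    unfolding map_eq_conv by auto
  then have "map (\<lambda>i. x (i + 1)) [0..<length es] = es \<longleftrightarrow> (\<forall>i<length es. x (i + 1) = es ! i)"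
    unfolding map_nth .
  then show ?thesis
    unfolding \<eta> cylinder_def path_prefix_def path_length_def by simp
qed

lemma path_prefix_mono:
  assumes "path_prefix m x = path_prefix m y" "n \<le> m"
  shows "path_prefix n x = path_prefix n y"
proof -
  have "brange (x 1) = brange (y 1)" "\<forall>i<m. x (Suc i) = y (Suc i)"
    using assms(1) by (simp_all add: path_prefix_def)
  then show ?thesis using assms(2) by (simp add: path_prefix_def)
qed

lemma path_prefix_Suc: "path_prefix (Suc n) x = append_edge (path_prefix n x) (x (Suc n))"
  by (simp add: path_prefix_def append_edge_def)

lemma cylinder_subset:
  "cylinder \<Lambda> \<eta> \<subseteq> infinite_paths \<Lambda>"
  by (auto simp: cylinder_def)

text \<open>The topology is generated by the cylinders as a subbasis; they form a basis because two
  cylinders around \<open>x\<close> both contain that of a longer prefix of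
  \<open>x\<close>.\<close>

lemma open_conv_cylinders:
  assumes "openin (path_topology \<Lambda>) U" "x \<in> U"
  shows "\<exists>\<eta>\<in>finite_paths \<Lambda>. x \<in> cylinder \<Lambda> \<eta> \<and> cylinder \<Lambda> \<eta> \<subseteq> U"
proof -
  have "generate_topology_on (cylinder \<Lambda> ` finite_paths \<Lambda>) U"
    using assms(1) unfolding path_topology_def by (rule openin_topology_generated_by)
  then have "\<forall>x\<in>U. \<exists>\<eta>\<in>finite_paths \<Lambda>. x \<in> cylinder \<Lambda> \<eta> \<and> cylinder \<Lambda> \<eta> \<subseteq> U"
  proof induction
    case (Int a b)
    show ?case
    proof
      fix x assume x: "x \<in> a \<inter> b"
      obtain \<eta>1 where 1: "\<eta>1 \<in> finite_paths \<Lambda>" "x \<in> cylinder \<Lambda> \<eta>1" "cylinder \<Lambda> \<eta>1 \<subseteq> a"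
        using Int.IH(1) x by blast
      obtain \<eta>2 where 2: "\<eta>2 \<in> finite_paths \<Lambda>" "x \<in> cylinder \<Lambda> \<eta>2" "cylinder \<Lambda> \<eta>2 \<subseteq> b"
        using Int.IH(2) x by blast
      define n where "n = max (path_length \<eta>1) (path_length \<eta>2)"
      have x': "x \<in> infinite_paths \<Lambda>" using 1(2) by (simp add: cylinder_iff)
      have "cylinder \<Lambda> (path_prefix n x) \<subseteq> cylinder \<Lambda> \<eta>"
        if \<eta>: "x \<in> cylinder \<Lambda> \<eta>" "path_length \<eta> \<le> n" for \<eta>
      proof
        fix y assume "y \<in> cylinder \<Lambda> (path_prefix n x)"
        then have y: "y \<in> infinite_paths \<Lambda>" "path_prefix n y = path_prefix n x"
          by (simp_all add: cylinder_iff)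
        show "y \<in> cylinder \<Lambda> \<eta>"
          using y(1) path_prefix_mono[OF y(2) \<eta>(2)] \<eta>(1) unfolding cylinder_iff by metis
      qed
      then have "cylinder \<Lambda> (path_prefix n x) \<subseteq> a \<inter> b"
        using 1 2 n_def by (meson Int_greatest max.cobounded1 max.cobounded2 order_trans)
      moreover have "x \<in> cylinder \<Lambda> (path_prefix n x)" using x' by (simp add: cylinder_iff)
      ultimately show "\<exists>\<eta>\<in>finite_paths \<Lambda>. x \<in> cylinder \<Lambda> \<eta> \<and> cylinder \<Lambda> \<eta> \<subseteq> a \<inter> b"
        using path_prefix_finite_paths[OF x'] by blast
    qed
  next
    case (UN K)
    then show ?case by (meson Union_iff Union_upper order_trans)
  qed auto
  then show ?thesis using assms(2) by blast
qed

text \<open>Unions of cylinders of paths of length \<open>n\<close>, described without naming the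
  paths. Taken over all \<open>n\<close>, these sets are closed under union and complement, unlike
  the cylinders alone, as the extension of a content to a measure requires.\<close>

definition determined :: "('a, 'b) kgraph_scheme \<Rightarrow> nat \<Rightarrow> (nat \<Rightarrow> 'a bedge) set \<Rightarrow> bool" where
  "determined \<Lambda> n A \<longleftrightarrow> A \<subseteq> infinite_paths \<Lambda> \<and>
     (\<forall>x\<in>A. \<forall>y\<in>infinite_paths \<Lambda>. path_prefix n x = path_prefix n y \<longrightarrow> y \<in> A)"

lemma determined_mono: "determined \<Lambda> n A \<Longrightarrow> n \<le> m \<Longrightarrow> determined \<Lambda> m A"
  unfolding determined_def using path_prefix_mono by blast

lemma determined_Un: "determined \<Lambda> n A \<Longrightarrow> determined \<Lambda> n B \<Longrightarrow> determined \<Lambda> n (A \<union> B)"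
  unfolding determined_def by blast

lemma determined_Diff: "determined \<Lambda> n A \<Longrightarrow> determined \<Lambda> n (infinite_paths \<Lambda> - A)"
  unfolding determined_def by (metis Diff_iff Diff_subset)

lemma determined_cylinder: "determined \<Lambda> (path_length \<eta>) (cylinder \<Lambda> \<eta>)"
  by (auto simp: determined_def cylinder_iff)

definition determined_sets :: "('a, 'b) kgraph_scheme \<Rightarrow> (nat \<Rightarrow> 'a bedge) set set" where
  "determined_sets \<Lambda> = {A. \<exists>n. determined \<Lambda> n A}"

lemma determined_setsI: "determined \<Lambda> n A \<Longrightarrow> A \<in> determined_sets \<Lambda>"
  by (auto simp: determined_sets_def)

lemma determined_common:
  assumes "A \<in> determined_sets \<Lambda>" "B \<in> determined_sets \<Lambda>"
  obtains n where "determined \<Lambda> n A" "determined \<Lambda> n B"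
proof -
  obtain n m where "determined \<Lambda> n A" "determined \<Lambda> m B"
    using assms by (auto simp: determined_sets_def)
  then have "determined \<Lambda> (max n m) A" "determined \<Lambda> (max n m) B"
    by (auto intro: determined_mono)
  then show thesis by (rule that)
qed

lemma algebra_determined_sets: "Sigma_Algebra.algebra (infinite_paths \<Lambda>) (determined_sets \<Lambda>)"
  unfolding algebra_iff_Un
proof (intro conjI ballI)
  show "determined_sets \<Lambda> \<subseteq> Pow (infinite_paths \<Lambda>)"
    by (auto simp: determined_sets_def determined_def)
  show "{} \<in> determined_sets \<Lambda>"
    by (auto simp: determined_sets_def determined_def)
  fix A assume A: "A \<in> determined_sets \<Lambda>"
  then show "infinite_paths \<Lambda> - A \<in> determined_sets \<Lambda>"
    by (auto simp: determined_sets_def intro: determined_Diff)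
  fix B assume "B \<in> determined_sets \<Lambda>"
  with A show "A \<union> B \<in> determined_sets \<Lambda>"
    by (metis determined_common determined_Un determined_setsI)
qed

lemma finite_paths_of_length:
  assumes "finite (vertices \<Lambda>)"
  shows "finite {\<eta> \<in> finite_paths \<Lambda>. path_length \<eta> = n}"
proof -
  have "{\<eta> \<in> finite_paths \<Lambda>. path_length \<eta> = n} \<subseteq> (\<Union>v\<in>vertices \<Lambda>. extensions_by \<Lambda> ((0, v), []) n)"
    by (auto simp: finite_paths_conv extensions_by_def)
  moreover have "finite (\<Union>v\<in>vertices \<Lambda>. extensions_by \<Lambda> ((0, v), []) n)"
    using assms by (intro finite_UN_I finite_extensions_by vertex_path)
  ultimately show ?thesis by (rule finite_subset)
qed

lemma countable_finite_paths:
  assumes "finite (vertices \<Lambda>)"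
  shows "countable (finite_paths \<Lambda>)"
proof -
  have "finite_paths \<Lambda> = (\<Union>n. {\<eta> \<in> finite_paths \<Lambda>. path_length \<eta> = n})" by auto
  moreover have "countable (\<Union>n. {\<eta> \<in> finite_paths \<Lambda>. path_length \<eta> = n})"
    using finite_paths_of_length[OF assms] by (intro countable_UN) (auto intro: countable_finite)
  ultimately show ?thesis by simp
qed

text \<open>A determined set is a union of cylinders, hence open. Conversely an open set is the
  union of the cylinders inside it, and there are only countably many because every length has
  finitely many paths.\<close>

lemma sigma_sets_determined_sets:
  assumes "finite (vertices \<Lambda>)"
  shows "sigma_sets (infinite_paths \<Lambda>) (determined_sets \<Lambda>) = path_borel_sets \<Lambda>"
  unfolding path_borel_sets_def
proof (rule sigma_sets_eqI)
  fix A assume "A \<in> determined_sets \<Lambda>"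
  then obtain n where n: "determined \<Lambda> n A" by (auto simp: determined_sets_def)
  have "A = \<Union>(cylinder \<Lambda> ` path_prefix n ` A)"
  proof (intro equalityI subsetI)
    fix x assume x: "x \<in> A"
    then have "x \<in> cylinder \<Lambda> (path_prefix n x)"
      using n by (auto simp: cylinder_iff determined_def)
    then show "x \<in> \<Union>(cylinder \<Lambda> ` path_prefix n ` A)" using x by blast
  next
    fix y assume "y \<in> \<Union>(cylinder \<Lambda> ` path_prefix n ` A)"
    then obtain x where "x \<in> A" "y \<in> cylinder \<Lambda> (path_prefix n x)" by blast
    then have "x \<in> A" "y \<in> infinite_paths \<Lambda>" "path_prefix n x = path_prefix n y"
      by (simp_all add: cylinder_iff)
    then show "y \<in> A" using n unfolding determined_def by blast
  qed
  moreover have "openin (path_topology \<Lambda>) (\<Union>(cylinder \<Lambda> ` path_prefix n ` A))"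
  proof (rule openin_Union)
    fix C assume "C \<in> cylinder \<Lambda> ` path_prefix n ` A"
    then obtain x where "x \<in> A" and C: "C = cylinder \<Lambda> (path_prefix n x)" by blast
    then have "path_prefix n x \<in> finite_paths \<Lambda>"
      using n by (intro path_prefix_finite_paths) (auto simp: determined_def)
    then have "C \<in> cylinder \<Lambda> ` finite_paths \<Lambda>" unfolding C by blast
    then show "openin (path_topology \<Lambda>) C"
      unfolding path_topology_def by (rule topology_generated_by_Basis)
  qed
  ultimately show "A \<in> sigma_sets (infinite_paths \<Lambda>) {U. openin (path_topology \<Lambda>) U}"
    by (intro sigma_sets.Basic) simp
next
  fix U assume "U \<in> {U. openin (path_topology \<Lambda>) U}"
  then have U: "openin (path_topology \<Lambda>) U" by simp
  define C where "C = {cylinder \<Lambda> \<eta> | \<eta>. \<eta> \<in> finite_paths \<Lambda> \<and> cylinder \<Lambda> \<eta> \<subseteq> U}"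
  have "C \<subseteq> cylinder \<Lambda> ` finite_paths \<Lambda>" by (auto simp: C_def)
  then have "countable C"
    by (rule countable_subset) (intro countable_image countable_finite_paths assms)
  moreover have "c \<in> sigma_sets (infinite_paths \<Lambda>) (determined_sets \<Lambda>)" if c: "c \<in> C" for c
  proof (rule sigma_sets.Basic)
    obtain \<eta> where "c = cylinder \<Lambda> \<eta>" using c unfolding C_def by blast
    then show "c \<in> determined_sets \<Lambda>" using determined_setsI[OF determined_cylinder] by simp
  qed
  ultimately have "\<Union>C \<in> sigma_sets (infinite_paths \<Lambda>) (determined_sets \<Lambda>)"
    by (rule sigma_sets_UNION)
  moreover have "\<Union>C = U"
  proof (intro equalityI subsetI)
    fix x assume "x \<in> U"
    then obtain \<eta> where "\<eta> \<in> finite_paths \<Lambda>" "x \<in> cylinder \<Lambda> \<eta>" "cylinder \<Lambda> \<eta> \<subseteq> U"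
      using open_conv_cylinders[OF U] by blast
    then show "x \<in> \<Union>C" unfolding C_def by blast
  qed (auto simp: C_def)
  ultimately show "U \<in> sigma_sets (infinite_paths \<Lambda>) (determined_sets \<Lambda>)" by simp
qed

section \<open>Compactness of the space of edge sequences\<close>

lemma finite_bedges:
  assumes "finite (vertices \<Lambda>)"
  shows "finite (bedges \<Lambda> n)"
proof -
  have "bedges \<Lambda> n = (\<lambda>(p, q, j). (n, p, q, j)) `
      (SIGMA p:vertices \<Lambda>. SIGMA q:vertices \<Lambda>. {..<adj \<Lambda> (colour \<Lambda> n) p q})"
    by (auto simp: bedges_def image_iff)
  moreover have "finite (SIGMA p:vertices \<Lambda>. SIGMA q:vertices \<Lambda>. {..<adj \<Lambda> (colour \<Lambda> n) p q})"
    using assms by (intro finite_SigmaI) auto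
  ultimately show ?thesis by simp
qed

text \<open>Adjacent edges need not fit together here, so this is a full product of discrete spaces,
  compact by Tychonoff when the levels are finite. The infinite paths form a closed subset and
  inherit compactness.\<close>

definition edge_topology :: "('a, 'b) kgraph_scheme \<Rightarrow> (nat \<Rightarrow> 'a bedge) topology" where
  "edge_topology \<Lambda> = product_topology (\<lambda>n. discrete_topology (bedges \<Lambda> n)) {1..}"

lemma topspace_edge_topology [simp]: "topspace (edge_topology \<Lambda>) = (\<Pi>\<^sub>E n\<in>{1..}. bedges \<Lambda> n)"
  by (simp add: edge_topology_def)

lemma compact_space_edge_topology:
  assumes "finite (vertices \<Lambda>)"
  shows "compact_space (edge_topology \<Lambda>)"
  unfolding edge_topology_def compact_space_product_topology
  using finite_bedges[OF assms] by (simp add: compact_space_discrete_topology)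

lemma openin_edge_topology:
  assumes "\<And>z. z \<in> U \<Longrightarrow> z \<in> (\<Pi>\<^sub>E n\<in>{1..}. bedges \<Lambda> n) \<and>
      (\<exists>N. \<forall>y\<in>(\<Pi>\<^sub>E n\<in>{1..}. bedges \<Lambda> n). (\<forall>i\<in>{1..N}. y i = z i) \<longrightarrow> y \<in> U)"
  shows "openin (edge_topology \<Lambda>) U"
proof (subst openin_subopen, intro ballI)
  fix z assume z: "z \<in> U"
  obtain N where z': "z \<in> (\<Pi>\<^sub>E n\<in>{1..}. bedges \<Lambda> n)"
    and N: "\<And>y. y \<in> (\<Pi>\<^sub>E n\<in>{1..}. bedges \<Lambda> n) \<Longrightarrow> (\<And>i. i \<in> {1..N} \<Longrightarrow> y i = z i) \<Longrightarrow> y \<in> U"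
    using assms[OF z] by blast
  define T where "T = (\<Pi>\<^sub>E n\<in>{1..}. if n \<le> N then {z n} else bedges \<Lambda> n)"
  have zn: "z n \<in> bedges \<Lambda> n" if "1 \<le> n" for n using z' that by (auto simp: PiE_iff)
  have "{i \<in> {1..}. (if i \<le> N then {z i} else bedges \<Lambda> i) \<noteq> bedges \<Lambda> i} \<subseteq> {..N}" by auto
  then have "finite {i \<in> {1..}. (if i \<le> N then {z i} else bedges \<Lambda> i) \<noteq> bedges \<Lambda> i}"
    by (rule finite_subset) simp
  then have "openin (edge_topology \<Lambda>) T"
    unfolding T_def edge_topology_def openin_PiE_gen using zn by simp
  moreover have "z \<in> T" using z' by (auto simp: T_def PiE_iff)
  moreover have "T \<subseteq> U"
  proof
    fix y assume y: "y \<in> T"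
    have "y \<in> (\<Pi>\<^sub>E n\<in>{1..}. bedges \<Lambda> n)"
      unfolding PiE_iff
    proof (intro conjI ballI)
      show "y \<in> extensional {1..}" using y by (simp add: T_def PiE_iff)
      fix i :: nat assume i: "i \<in> {1..}"
      then show "y i \<in> bedges \<Lambda> i"
        using y zn[of i] by (cases "i \<le> N") (auto simp: T_def PiE_iff dest!: bspec[of _ _ i])
    qed
    moreover have "y i = z i" if "i \<in> {1..N}" for i
      using y that by (auto simp: T_def PiE_iff dest!: bspec[of _ _ i])
    ultimately show "y \<in> U" by (rule N)
  qed
  ultimately show "\<exists>T. openin (edge_topology \<Lambda>) T \<and> z \<in> T \<and> T \<subseteq> U" by blast
qed

lemma closedin_determined:
  assumes "determined \<Lambda> n A"
  shows "closedin (edge_topology \<Lambda>) A"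
  unfolding closedin_def
proof (intro conjI)
  show "A \<subseteq> topspace (edge_topology \<Lambda>)"
    using assms by (auto simp: determined_def infinite_paths_def)
  show "openin (edge_topology \<Lambda>) (topspace (edge_topology \<Lambda>) - A)"
  proof (rule openin_edge_topology)
    fix z assume "z \<in> topspace (edge_topology \<Lambda>) - A"
    then have z: "z \<in> (\<Pi>\<^sub>E n\<in>{1..}. bedges \<Lambda> n)" "z \<notin> A" by simp_all
    have "\<exists>N. \<forall>y\<in>(\<Pi>\<^sub>E n\<in>{1..}. bedges \<Lambda> n). (\<forall>i\<in>{1..N}. y i = z i) \<longrightarrow> y \<notin> A"
    proof (cases "z \<in> infinite_paths \<Lambda>")
      case True
      \<comment> \<open>Even the prefix of length \<open>0\<close> reads edge \<open>1\<close>, for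
        its range; hence \<open>max n 1\<close>.\<close>
      have "y \<notin> A" if "\<And>i. i \<in> {1..max n 1} \<Longrightarrow> y i = z i" for y
      proof
        assume "y \<in> A"
        moreover have "path_prefix n y = path_prefix n z"
          using that by (auto simp: path_prefix_def)
        ultimately show False using assms True z(2) unfolding determined_def by blast
      qed
      then show ?thesis by blast
    next
      case False
      then obtain m where m: "1 \<le> m" "bsource (z m) \<noteq> brange (z (m + 1))"
        using z(1) by (auto simp: infinite_paths_def)
      \<comment> \<open>The mismatch between the edges \<open>m\<close> and \<open>m + 1\<close> is
        visible in finitely many coordinates, and no member of \<open>A\<close> can share
        it.\<close>
      have "y \<notin> A" if y: "\<And>i. i \<in> {1..m + 1} \<Longrightarrow> y i = z i" for y
      proof
        assume "y \<in> A"
        then have "y \<in> infinite_paths \<Lambda>" using assms by (auto simp: determined_def)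
        then have "bsource (y m) = brange (y (m + 1))" using m(1) by (auto simp: infinite_paths_def)
        then show False using m y[of m] y[of "m + 1"] by simp
      qed
      then show ?thesis by blast
    qed
    then show "z \<in> (\<Pi>\<^sub>E n\<in>{1..}. bedges \<Lambda> n) \<and>
        (\<exists>N. \<forall>y\<in>(\<Pi>\<^sub>E n\<in>{1..}. bedges \<Lambda> n). (\<forall>i\<in>{1..N}. y i = z i) \<longrightarrow> y \<in> topspace (edge_topology \<Lambda>) - A)"
      using z(1) by simp
  qed
qed

text \<open>Determined sets are closed in a compact space, so a nested sequence of nonempty ones
  would have a common point.\<close>

lemma determined_decseq_empty:
  assumes "finite (vertices \<Lambda>)" and A: "range A \<subseteq> determined_sets \<Lambda>" and dec: "decseq A"
    and empty: "(\<Inter>i. A i) = {}"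
  obtains i :: nat where "A i = {}"
proof -
  have "closedin (edge_topology \<Lambda>) (A i)" for i
    using A closedin_determined by (auto simp: determined_sets_def)
  then show thesis
    using compact_space_imp_nest[OF compact_space_edge_topology[OF assms(1)], of A] dec empty that by blast
qed

text \<open>Nonempty cylinders ensure that no mass sits on a finite path without infinite
  continuation; otherwise a set of infinite paths would not see every term of
  \<open>L_next_edges\<close>.\<close>

locale path_content =
  fixes \<Lambda> :: "('a, 'b) kgraph_scheme" and L :: "'a bpath \<Rightarrow> real"
  assumes finite_V: "finite (vertices \<Lambda>)"
    and cylinder_nonempty: "\<And>\<eta>. \<eta> \<in> finite_paths \<Lambda> \<Longrightarrow> cylinder \<Lambda> \<eta> \<noteq> {}"
    and L_nonneg: "\<And>\<eta>. \<eta> \<in> finite_paths \<Lambda> \<Longrightarrow> 0 \<le> L \<eta>"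
    and L_next_edges: "\<And>\<eta>. \<eta> \<in> finite_paths \<Lambda> \<Longrightarrow> (\<Sum>e\<in>next_edges \<Lambda> \<eta>. L (append_edge \<eta> e)) = L \<eta>"
begin

definition content_at :: "nat \<Rightarrow> (nat \<Rightarrow> 'a bedge) set \<Rightarrow> real" where
  "content_at n A = (\<Sum>\<eta>\<in>path_prefix n ` A. L \<eta>)"

text \<open>\<open>LEAST\<close> merely selects a canonical level; \<open>content_eq\<close> shows
  that every level determining the set gives the same value.\<close>

definition content :: "(nat \<Rightarrow> 'a bedge) set \<Rightarrow> real" where
  "content A = content_at (LEAST n. determined \<Lambda> n A) A"

lemma prefix_image_subset:
  "A \<subseteq> infinite_paths \<Lambda> \<Longrightarrow> path_prefix n ` A \<subseteq> {\<eta> \<in> finite_paths \<Lambda>. path_length \<eta> = n}"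
  by (auto intro!: path_prefix_finite_paths)

lemma finite_prefix_image: "A \<subseteq> infinite_paths \<Lambda> \<Longrightarrow> finite (path_prefix n ` A)"
  by (rule finite_subset[OF prefix_image_subset finite_paths_of_length[OF finite_V]])

lemma content_at_Suc:
  assumes A: "determined \<Lambda> n A"
  shows "content_at (Suc n) A = content_at n A"
proof -
  have sub: "A \<subseteq> infinite_paths \<Lambda>" using A by (simp add: determined_def)
  have img: "path_prefix (Suc n) ` A = (\<Union>\<eta>\<in>path_prefix n ` A. append_edge \<eta> ` next_edges \<Lambda> \<eta>)"
  proof (intro equalityI subsetI)
    fix \<eta>' assume "\<eta>' \<in> path_prefix (Suc n) ` A"
    then obtain x where x: "x \<in> A" "\<eta>' = append_edge (path_prefix n x) (x (Suc n))"
      by (auto simp: path_prefix_Suc)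
    moreover have "\<eta>' \<in> finite_paths \<Lambda>"
      using path_prefix_finite_paths[of x \<Lambda> "Suc n"] x sub by (auto simp: path_prefix_Suc)
    ultimately have "x (Suc n) \<in> next_edges \<Lambda> (path_prefix n x)"
      by (simp add: append_edge_finite_paths_iff)
    then show "\<eta>' \<in> (\<Union>\<eta>\<in>path_prefix n ` A. append_edge \<eta> ` next_edges \<Lambda> \<eta>)"
      using x by blast
  next
    fix \<eta>' assume "\<eta>' \<in> (\<Union>\<eta>\<in>path_prefix n ` A. append_edge \<eta> ` next_edges \<Lambda> \<eta>)"
    then obtain x e where x: "x \<in> A" and e: "e \<in> next_edges \<Lambda> (path_prefix n x)"
      and \<eta>': "\<eta>' = append_edge (path_prefix n x) e" by blast
    have "\<eta>' \<in> finite_paths \<Lambda>"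
      using path_prefix_finite_paths x sub e by (auto simp: \<eta>' append_edge_finite_paths_iff)
    \<comment> \<open>The extended prefix need not come from \<open>x\<close> itself; a nonempty
      cylinder provides another path \<open>y\<close> with this prefix, and \<open>y\<close> lies in
      \<open>A\<close> because its first \<open>n\<close> edges agree with those of
      \<open>x\<close>.\<close>
    then obtain y where "y \<in> cylinder \<Lambda> \<eta>'" using cylinder_nonempty by blast
    then have y: "y \<in> infinite_paths \<Lambda>" "path_prefix (Suc n) y = \<eta>'"
      by (auto simp: cylinder_iff \<eta>')
    then have "path_prefix n x = path_prefix n y" by (simp add: path_prefix_Suc \<eta>')
    then have "y \<in> A" using A x y(1) unfolding determined_def by blast
    then show "\<eta>' \<in> path_prefix (Suc n) ` A" using y(2) by blast
  qed
  have fp: "\<eta> \<in> finite_paths \<Lambda>" if "\<eta> \<in> path_prefix n ` A" for \<eta>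
    using that prefix_image_subset[OF sub] by blast
  have "content_at (Suc n) A = (\<Sum>\<eta>\<in>path_prefix n ` A. \<Sum>\<eta>'\<in>append_edge \<eta> ` next_edges \<Lambda> \<eta>. L \<eta>')"
    unfolding content_at_def img
    using finite_prefix_image[OF sub] finite_next_edges[OF finite_V] fp
    by (intro sum.UNION_disjoint) auto
  also have "\<dots> = (\<Sum>\<eta>\<in>path_prefix n ` A. L \<eta>)"
    using fp by (intro sum.cong refl) (simp add: sum.reindex inj_on_def L_next_edges)
  finally show ?thesis by (simp add: content_at_def)
qed

lemma content_at_eq:
  assumes A: "determined \<Lambda> n A" and "n \<le> m"
  shows "content_at m A = content_at n A"
  using assms(2)
proof (induction m rule: dec_induct)
  case (step m)
  then show ?case using content_at_Suc determined_mono[OF A] by simp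
qed simp

lemma content_eq:
  assumes "determined \<Lambda> n A"
  shows "content A = content_at n A"
proof -
  have "determined \<Lambda> (LEAST n. determined \<Lambda> n A) A" using assms by (rule LeastI)
  moreover have "(LEAST n. determined \<Lambda> n A) \<le> n" using assms by (rule Least_le)
  ultimately show ?thesis unfolding content_def by (rule content_at_eq[symmetric])
qed

lemma content_nonneg: "A \<in> determined_sets \<Lambda> \<Longrightarrow> 0 \<le> content A"
proof -
  assume "A \<in> determined_sets \<Lambda>"
  then obtain n where n: "determined \<Lambda> n A" by (auto simp: determined_sets_def)
  then have "path_prefix n ` A \<subseteq> {\<eta> \<in> finite_paths \<Lambda>. path_length \<eta> = n}"
    by (intro prefix_image_subset) (simp add: determined_def)
  then show ?thesis
    unfolding content_eq[OF n] content_at_def using L_nonneg by (intro sum_nonneg) blast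
qed

lemma content_empty: "content {} = 0"
  by (simp add: content_def content_at_def)

text \<open>At a level that determines both sets, disjoint sets have disjoint sets of
  prefixes.\<close>

lemma content_Un:
  assumes "A \<in> determined_sets \<Lambda>" "B \<in> determined_sets \<Lambda>" "A \<inter> B = {}"
  shows "content (A \<union> B) = content A + content B"
proof -
  obtain n where n: "determined \<Lambda> n A" "determined \<Lambda> n B"
    using determined_common[OF assms(1,2)] by blast
  have "path_prefix n ` A \<inter> path_prefix n ` B = {}"
  proof (rule ccontr)
    assume "\<not> ?thesis"
    then obtain x y where "x \<in> A" "y \<in> B" "path_prefix n x = path_prefix n y" by blast
    then show False using n assms(3) unfolding determined_def by blast
  qed
  moreover have "finite (path_prefix n ` A)" "finite (path_prefix n ` B)"
    using n by (auto simp: determined_def intro!: finite_prefix_image)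
  ultimately show ?thesis
    unfolding content_eq[OF n(1)] content_eq[OF n(2)] content_eq[OF determined_Un[OF n]]
      content_at_def image_Un
    by (intro sum.union_disjoint) auto
qed

lemma content_cylinder:
  assumes "\<eta> \<in> finite_paths \<Lambda>"
  shows "content (cylinder \<Lambda> \<eta>) = L \<eta>"
proof -
  have "path_prefix (path_length \<eta>) ` cylinder \<Lambda> \<eta> \<subseteq> {\<eta>}"
    by (simp add: image_subset_iff cylinder_iff)
  then have "path_prefix (path_length \<eta>) ` cylinder \<Lambda> \<eta> = {\<eta>}"
    using cylinder_nonempty[OF assms] by (simp add: subset_singleton_iff)
  then show ?thesis by (simp add: content_eq[OF determined_cylinder] content_at_def)
qed

text \<open>Caratheodory extension: countable additivity reduces to continuity at the empty set,
  where compactness makes the contents not only small but eventually \<open>0\<close>.\<close>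

lemma exists_measure:
  "\<exists>\<mu>. finite_measure \<mu> \<and> space \<mu> = infinite_paths \<Lambda> \<and> sets \<mu> = path_borel_sets \<Lambda> \<and>
    (\<forall>\<eta>\<in>finite_paths \<Lambda>. measure \<mu> (cylinder \<Lambda> \<eta>) = L \<eta>)"
proof -
  interpret Sigma_Algebra.algebra "infinite_paths \<Lambda>" "determined_sets \<Lambda>"
    by (rule algebra_determined_sets)
  have "\<exists>\<mu> :: _ \<Rightarrow> ennreal. (\<forall>A\<in>determined_sets \<Lambda>. \<mu> A = ennreal (content A)) \<and>
      measure_space (infinite_paths \<Lambda>) (sigma_sets (infinite_paths \<Lambda>) (determined_sets \<Lambda>)) \<mu>"
  proof (rule caratheodory_empty_continuous)
    show "positive (determined_sets \<Lambda>) (\<lambda>A. ennreal (content A))"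
      by (simp add: positive_def content_empty)
    show "additive (determined_sets \<Lambda>) (\<lambda>A. ennreal (content A))"
      unfolding additive_def by (auto simp: content_Un content_nonneg)
  next
    fix A assume A: "range A \<subseteq> determined_sets \<Lambda>" "decseq A" "(\<Inter>i. A i) = {}"
    then obtain i where i: "A i = {}"
      using determined_decseq_empty[OF finite_V] by blast
    have "A n = {}" if "i \<le> n" for n
      using decseqD[OF A(2) that] i by simp
    then have "\<forall>\<^sub>F n in sequentially. ennreal (content (A n)) = 0"
      unfolding eventually_sequentially using content_empty by (intro exI[of _ i]) simp
    then show "(\<lambda>n. ennreal (content (A n))) \<longlonglongrightarrow> 0"
      by (rule tendsto_eventually)
  qed simp
  then obtain \<mu> :: "_ \<Rightarrow> ennreal" where \<mu>: "\<And>A. A \<in> determined_sets \<Lambda> \<Longrightarrow> \<mu> A = ennreal (content A)"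
    and ms: "measure_space (infinite_paths \<Lambda>) (path_borel_sets \<Lambda>) \<mu>"
    using sigma_sets_determined_sets[OF finite_V] by auto
  define M where "M = measure_of (infinite_paths \<Lambda>) (path_borel_sets \<Lambda>) \<mu>"
  have sa: "sigma_algebra (infinite_paths \<Lambda>) (path_borel_sets \<Lambda>)"
    using ms by (simp add: measure_space_def)
  then have pow: "path_borel_sets \<Lambda> \<subseteq> Pow (infinite_paths \<Lambda>)"
    by (simp add: sigma_algebra_iff2)
  have det: "A \<in> path_borel_sets \<Lambda>" if "A \<in> determined_sets \<Lambda>" for A
    using that sigma_sets_determined_sets[OF finite_V] by auto
  have em: "emeasure M A = ennreal (content A)" if "A \<in> determined_sets \<Lambda>" for A
    using emeasure_measure_of_sigma[OF sa, of \<mu> A] ms det[OF that] \<mu>[OF that]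
    by (simp add: M_def measure_space_def)
  have space: "space M = infinite_paths \<Lambda>"
    unfolding M_def using pow by (rule space_measure_of)
  have "sets M = path_borel_sets \<Lambda>"
    unfolding M_def using pow sa by (simp add: sets_measure_of sigma_algebra.sigma_sets_eq)
  moreover have "finite_measure M"
    using em[OF top] by (intro finite_measureI) (simp add: space)
  moreover have "measure M (cylinder \<Lambda> \<eta>) = L \<eta>" if "\<eta> \<in> finite_paths \<Lambda>" for \<eta>
    using em[OF determined_setsI[OF determined_cylinder]] L_nonneg[OF that]
    by (simp add: measure_def content_cylinder[OF that])
  ultimately show ?thesis using space by blast
qed

end

section \<open>Expansion from the diameter condition\<close>

text \<open>The empty set and a singleton both have diameter \<open>0\<close>. The inclusion in
  \<open>{z}\<close> excludes the two cases together, so any choice of \<open>z\<close> also yields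
  nonemptiness.\<close>

lemma cylinder_not_singleton:
  assumes "weight \<Lambda> \<delta> \<eta> = path_diam \<Lambda> \<delta> (cylinder \<Lambda> \<eta>)" "weight \<Lambda> \<delta> \<eta> \<noteq> 0"
  shows "\<not> cylinder \<Lambda> \<eta> \<subseteq> {z}"
proof
  assume "cylinder \<Lambda> \<eta> \<subseteq> {z}"
  then have "cylinder \<Lambda> \<eta> = {} \<or> cylinder \<Lambda> \<eta> = {z}" by blast
  then have "path_diam \<Lambda> \<delta> (cylinder \<Lambda> \<eta>) = 0"
  proof
    assume "cylinder \<Lambda> \<eta> = {z}"
    moreover have "{path_dist \<Lambda> \<delta> x y |x y. x \<in> {z} \<and> y \<in> {z}} = {0}"
      by (auto simp: path_dist_def)
    ultimately show ?thesis by (simp add: path_diam_def)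
  qed (simp add: path_diam_def)
  with assms show False by simp
qed

text \<open>At a vertex where the Perron--Frobenius vector is minimal the eigenvalue is at least the
  number of outgoing edges. If all eigenvalues were \<open>1\<close>, exactly one edge of each colour would leave
  that vertex, and it would lead to another such vertex.\<close>

lemma minimal_vertex_edge:
  assumes fin: "finite (vertices \<Lambda>)" and pf: "is_pf_eigenvector \<Lambda> x" and i: "i \<in> {1..rank \<Lambda>}"
    and v: "v \<in> vertices \<Lambda>" and min: "\<And>w. w \<in> vertices \<Lambda> \<Longrightarrow> x v \<le> x w"
    and w: "w \<in> vertices \<Lambda>" "j < adj \<Lambda> i v w"
  shows "1 \<le> rho \<Lambda> i"
    and "rho \<Lambda> i \<le> 1 \<Longrightarrow> x w = x v"
    and "rho \<Lambda> i \<le> 1 \<Longrightarrow> w' \<in> vertices \<Lambda> \<Longrightarrow> j' < adj \<Lambda> i v w' \<Longrightarrow> w' = w \<and> j' = j"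
proof -
  have pos: "0 < x w" if "w \<in> vertices \<Lambda>" for w
    using pf that by (simp add: is_pf_eigenvector_def)
  have eq: "(\<Sum>w\<in>vertices \<Lambda>. real (adj \<Lambda> i v w) * x w) = rho \<Lambda> i * x v"
    using pf i v unfolding is_pf_eigenvector_def by blast
  have nonneg: "0 \<le> real (adj \<Lambda> i v w) * x w" if "w \<in> vertices \<Lambda>" for w
    using pos[OF that] by simp
  have one: "real (adj \<Lambda> i v w) * x w \<le> rho \<Lambda> i * x v" if "w \<in> vertices \<Lambda>" for w
    unfolding eq[symmetric] using nonneg that fin by (intro member_le_sum) auto
  have "x w \<le> real (adj \<Lambda> i v w) * x w"
    using w pos[OF w(1)] by (simp add: mult_le_cancel_right1)
  then have le: "x w \<le> rho \<Lambda> i * x v" using one[OF w(1)] by simp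
  then have "1 * x v \<le> rho \<Lambda> i * x v" using min[OF w(1)] by simp
  then show "1 \<le> rho \<Lambda> i" using pos[OF v] by simp
  assume "rho \<Lambda> i \<le> 1"
  then have le1: "rho \<Lambda> i * x v \<le> x v" using pos[OF v] by (simp add: mult_left_le_one_le)
  show "x w = x v" using le le1 min[OF w(1)] by simp
  assume w': "w' \<in> vertices \<Lambda>" "j' < adj \<Lambda> i v w'"
  \<comment> \<open>Two different targets would contribute at least \<open>2 * x v\<close> to a sum
    that is at most \<open>x v\<close>; two parallel edges are excluded below in the same
    way.\<close>
  have "w' = w"
  proof (rule ccontr)
    assume "w' \<noteq> w"
    have "x w' \<le> real (adj \<Lambda> i v w') * x w'"
      using w' pos[OF w'(1)] by (simp add: mult_le_cancel_right1)
    moreover have "(\<Sum>u\<in>{w, w'}. real (adj \<Lambda> i v u) * x u) \<le> rho \<Lambda> i * x v"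
      unfolding eq[symmetric] using nonneg w w' fin by (intro sum_mono2) auto
    moreover have "(\<Sum>u\<in>{w, w'}. real (adj \<Lambda> i v u) * x u)
        = real (adj \<Lambda> i v w) * x w + real (adj \<Lambda> i v w') * x w'"
      using \<open>w' \<noteq> w\<close> by simp
    ultimately show False
      using \<open>x w \<le> real (adj \<Lambda> i v w) * x w\<close> le1 min[OF w(1)] min[OF w'(1)] pos[OF v] by linarith
  qed
  moreover have "adj \<Lambda> i v w < 2"
  proof (rule ccontr)
    assume "\<not> adj \<Lambda> i v w < 2"
    then have "2 * x w \<le> real (adj \<Lambda> i v w) * x w"
      using pos[OF w(1)] by (intro mult_right_mono) auto
    then show False using one[OF w(1)] le1 min[OF w(1)] pos[OF w(1)] by linarith
  qed
  ultimately show "w' = w \<and> j' = j" using w w' by auto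
qed

lemma rho_pos:
  assumes "is_pf_eigenvector \<Lambda> x" "i \<in> {1..rank \<Lambda>}" and fin: "finite (vertices \<Lambda>)"
    and v: "v \<in> vertices \<Lambda>" and w: "w \<in> vertices \<Lambda>" "0 < adj \<Lambda> i v w"
  shows "0 < rho \<Lambda> i"
proof -
  have pos: "0 < x w" if "w \<in> vertices \<Lambda>" for w
    using assms(1) that by (simp add: is_pf_eigenvector_def)
  have "0 < (\<Sum>w\<in>vertices \<Lambda>. real (adj \<Lambda> i v w) * x w)"
  proof (rule sum_pos2[OF fin w(1)])
    show "0 < real (adj \<Lambda> i v w) * x w" using w pos[OF w(1)] by simp
    show "0 \<le> real (adj \<Lambda> i v u) * x u" if "u \<in> vertices \<Lambda>" for u using pos[OF that] by simp
  qed
  also have "\<dots> = rho \<Lambda> i * x v" using assms(1,2) v unfolding is_pf_eigenvector_def by blast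
  finally show ?thesis using pos[OF v] by (simp add: zero_less_mult_iff)
qed

text \<open>The order of the steps matters, since a spectral radius \<open>0\<close> would make
  weights vanish. Paths of length \<open>0\<close> have weight \<open>x v > 0\<close> in any case,
  so their cylinders are nonempty. An infinite path from there crosses every colour, whence all
  spectral radii are positive; only then do all finite paths have nonzero weight and nonempty
  cylinders.\<close>

lemma expanding_diagram_kgraph:
  fixes \<Lambda> :: "'a kgraph"
  assumes kgraph: "k_graph \<Lambda>" and fin: "finite_kgraph \<Lambda>" and sc: "strongly_connected \<Lambda>"
    and ne: "vertices \<Lambda> \<noteq> {}" and \<delta>: "0 < \<delta>"
    and diam: "\<And>\<eta>. \<eta> \<in> finite_paths \<Lambda> \<Longrightarrow> weight \<Lambda> \<delta> \<eta> = path_diam \<Lambda> \<delta> (cylinder \<Lambda> \<eta>)"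
  shows "expanding_diagram \<Lambda> \<delta>"
proof -
  define x where "x = pf_eigenvector \<Lambda>"
  have rank: "1 \<le> rank \<Lambda>" using kgraph by (simp add: k_graph_def)
  note finV = finite_vertices[OF kgraph fin]
  have pf: "is_pf_eigenvector \<Lambda> x"
    unfolding x_def by (rule is_pf_eigenvector_pf_eigenvector[OF kgraph fin sc ne])
  have x_pos: "0 < x v" if "v \<in> vertices \<Lambda>" for v
    using pf that by (simp add: is_pf_eigenvector_def)
  have vertex_cylinder: "\<not> cylinder \<Lambda> ((0, v), []) \<subseteq> {z}" if v: "v \<in> vertices \<Lambda>" for v z
  proof (rule cylinder_not_singleton[OF diam[OF vertex_path[OF v]]])
    show "weight \<Lambda> \<delta> ((0, v), []) \<noteq> 0"
      using x_pos[OF v] by (simp add: weight_conv[OF rank] level_rho_def x_def)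
  qed
  obtain v0 where v0: "v0 \<in> vertices \<Lambda>" using ne by blast
  obtain z where "z \<in> cylinder \<Lambda> ((0, v0), [])" using vertex_cylinder[OF v0, of undefined] by blast
  then have z: "z \<in> infinite_paths \<Lambda>" by (simp add: cylinder_iff)
  have edge: "z i \<in> bedges \<Lambda> i" if "1 \<le> i" for i
    using z that by (rule infinite_paths_bedges)
  have colour_id: "colour \<Lambda> i = i" if "i \<in> {1..rank \<Lambda>}" for i
    using that by (auto simp: colour_def)
  have rho: "0 < rho \<Lambda> i" if i: "i \<in> {1..rank \<Lambda>}" for i
  proof -
    obtain p q j where "p \<in> vertices \<Lambda>" "q \<in> vertices \<Lambda>" "j < adj \<Lambda> i p q"
      using edge[of i] i colour_id[OF i] by (auto simp: bedges_iff)
    then show ?thesis using rho_pos[OF pf i finV] by auto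
  qed
  have level_rho_pos: "0 < level_rho \<Lambda> n" for n
    unfolding level_rho_def using rho rank by (intro prod_pos) (auto simp: colour_def Suc_le_eq)
  have cyl: "\<not> cylinder \<Lambda> \<eta> \<subseteq> {z}" if "\<eta> \<in> finite_paths \<Lambda>" for \<eta> z
  proof (rule cylinder_not_singleton[OF diam[OF that]])
    show "weight \<Lambda> \<delta> \<eta> \<noteq> 0"
      using level_rho_pos[of "path_length \<eta>"] x_pos[OF path_source_conv(2)[OF that]]
      by (simp add: weight_conv[OF rank] x_def)
  qed
  have out_edge: "\<exists>w\<in>vertices \<Lambda>. 0 < adj \<Lambda> i v w" if i: "i \<in> {1..rank \<Lambda>}" and v: "v \<in> vertices \<Lambda>" for i v
  proof (rule ccontr)
    assume "\<not> ?thesis"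
    then have "(\<Sum>w\<in>vertices \<Lambda>. real (adj \<Lambda> i v w) * x w) = 0" by simp
    moreover have "(\<Sum>w\<in>vertices \<Lambda>. real (adj \<Lambda> i v w) * x w) = rho \<Lambda> i * x v"
      using pf i v unfolding is_pf_eigenvector_def by blast
    ultimately show False using rho[OF i] x_pos[OF v] by simp
  qed
  have "Min (x ` vertices \<Lambda>) \<in> x ` vertices \<Lambda>" using finV ne by (intro Min_in) auto
  then obtain v where v: "v \<in> vertices \<Lambda>" "x v = Min (x ` vertices \<Lambda>)" by force
  have min: "x v \<le> x w" if "w \<in> vertices \<Lambda>" for w
    unfolding v(2) using that finV by (intro Min_le) auto
  have rho_ge_1: "1 \<le> rho \<Lambda> i" if i: "i \<in> {1..rank \<Lambda>}" for i
    using out_edge[OF i v(1)] minimal_vertex_edge(1)[OF finV pf i v(1) min] by blast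
  have "1 < (\<Prod>i\<in>{1..rank \<Lambda>}. rho \<Lambda> i)"
  proof (rule ccontr)
    assume not: "\<not> ?thesis"
    \<comment> \<open>All factors are at least \<open>1\<close> and their product is at most
      \<open>1\<close>, so no factor exceeds \<open>1\<close>.\<close>
    have rho1: "rho \<Lambda> i \<le> 1" if i: "i \<in> {1..rank \<Lambda>}" for i
    proof -
      have "rho \<Lambda> i * 1 \<le> rho \<Lambda> i * (\<Prod>l\<in>{1..rank \<Lambda>} - {i}. rho \<Lambda> l)"
        using rho[OF i] rho_ge_1 by (intro mult_left_mono prod_ge_1) auto
      also have "\<dots> = (\<Prod>l\<in>{1..rank \<Lambda>}. rho \<Lambda> l)"
        using i by (simp add: prod.remove)
      finally show ?thesis using not by simp
    qed
    have col: "colour \<Lambda> n \<in> {1..rank \<Lambda>}" for n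
      using rank by (auto simp: colour_def Suc_le_eq)
    \<comment> \<open>The vertex may change along the path; what persists is the minimal value
      \<open>x v\<close>, and at every vertex with this value the next edge is forced.\<close>
    have step: "e = e' \<and> x (snd (bsource e)) = x v"
      if e: "e \<in> bedges \<Lambda> n" "e' \<in> bedges \<Lambda> n" "brange e = brange e'" "x (snd (brange e)) = x v" for e e' n
    proof -
      obtain p q j q' j' where eqs: "e = (n, p, q, j)" "e' = (n, p, q', j')"
        and pq: "p \<in> vertices \<Lambda>" "q \<in> vertices \<Lambda>" "j < adj \<Lambda> (colour \<Lambda> n) p q"
          "q' \<in> vertices \<Lambda>" "j' < adj \<Lambda> (colour \<Lambda> n) p q'"
        using e by (auto simp: bedges_iff)
      have xp: "x p = x v" using e(4) by (simp add: eqs)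
      then have "x p \<le> x w" if "w \<in> vertices \<Lambda>" for w using min[OF that] by simp
      note m = minimal_vertex_edge[OF finV pf col pq(1) this pq(2,3)]
      show ?thesis using m(2)[OF _ rho1[OF col]] m(3)[OF _ rho1[OF col] pq(4,5)] xp by (simp add: eqs)
    qed
    obtain y where y: "y \<in> cylinder \<Lambda> ((0, v), [])" using vertex_cylinder[OF v(1), of undefined] by blast
    have "cylinder \<Lambda> ((0, v), []) \<subseteq> {y}"
    proof
      fix y' assume y': "y' \<in> cylinder \<Lambda> ((0, v), [])"
      have inf: "y \<in> infinite_paths \<Lambda>" "y' \<in> infinite_paths \<Lambda>" "brange (y 1) = (0, v)" "brange (y' 1) = (0, v)"
        using y y' by (auto simp: cylinder_def)
      have "y (Suc n) = y' (Suc n) \<and> x (snd (bsource (y (Suc n)))) = x v" for n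
      proof (induction n)
        case 0
        show ?case
          using step[OF infinite_paths_bedges[OF inf(1)] infinite_paths_bedges[OF inf(2)], of 1] inf by auto
      next
        case (Suc n)
        have "bsource (y (Suc n)) = brange (y (Suc (Suc n)))" "bsource (y' (Suc n)) = brange (y' (Suc (Suc n)))"
          using inf by (auto simp: infinite_paths_def)
        then show ?case
          using Suc step[OF infinite_paths_bedges[OF inf(1)] infinite_paths_bedges[OF inf(2)], of "Suc (Suc n)"]
          by auto
      qed
      then have "y i = y' i" if "1 \<le> i" for i using that by (cases i) auto
      then have "y' = y"
        using inf by (intro PiE_ext[of _ "{1..}" "bedges \<Lambda>"]) (auto simp: infinite_paths_def)
      then show "y' \<in> {y}" by simp
    qed
    then show False using vertex_cylinder[OF v(1)] by blast
  qed
  then show ?thesis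
    using rank finV ne \<delta> pf rho cyl unfolding x_def by unfold_locales blast+
qed

theorem theorem3p9:
  fixes \<Lambda> :: "'a kgraph" and \<delta> :: real
  assumes "k_graph \<Lambda>"
    and "finite_kgraph \<Lambda>"
    and "strongly_connected \<Lambda>"
    and "0 < \<delta>" and "\<delta> < 1"
    and "\<And>\<eta>. \<eta> \<in> finite_paths \<Lambda> \<Longrightarrow> weight \<Lambda> \<delta> \<eta> = path_diam \<Lambda> \<delta> (cylinder \<Lambda> \<eta>)"
  shows "(\<forall>s>\<delta>. (\<lambda>\<eta>. weight \<Lambda> \<delta> \<eta> powr s) summable_on finite_paths \<Lambda>) \<and>
    (\<exists>\<mu>. finite_measure \<mu> \<and>
         space \<mu> = infinite_paths \<Lambda> \<and>
         sets \<mu> = path_borel_sets \<Lambda> \<and>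
         (\<forall>\<gamma>\<in>finite_paths \<Lambda>.
            ((\<lambda>s. (\<Sum>\<^sub>\<infinity>\<eta>\<in>extensions \<Lambda> \<gamma>. weight \<Lambda> \<delta> \<eta> powr s) / zeta \<Lambda> \<delta> s)
               \<longlongrightarrow> measure \<mu> (cylinder \<Lambda> \<gamma>)) (at_right \<delta>)))"
proof (cases "vertices \<Lambda> = {}")
  case True
  then have empty: "finite_paths \<Lambda> = {}" by (simp add: finite_paths_conv)
  \<comment> \<open>The empty graph satisfies the hypotheses. Without finite paths only some finite
    measure on the path space is required, and the zero function yields one.\<close>
  interpret path_content \<Lambda> "\<lambda>_. 0"
    by unfold_locales (simp_all add: True empty)
  show ?thesis using exists_measure by (simp add: empty)
next
  case False
  interpret expanding_diagram \<Lambda> \<delta>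
    using assms False by (intro expanding_diagram_kgraph)
  interpret path_content \<Lambda> path_mass
    by unfold_locales (simp_all add: finite_V cylinder_nonempty path_mass_nonneg path_mass_next_edges)
  obtain \<mu> where "finite_measure \<mu>" "space \<mu> = infinite_paths \<Lambda>" "sets \<mu> = path_borel_sets \<Lambda>"
    and "\<And>\<eta>. \<eta> \<in> finite_paths \<Lambda> \<Longrightarrow> measure \<mu> (cylinder \<Lambda> \<eta>) = path_mass \<eta>"
    using exists_measure by blast
  then show ?thesis
    using path_mass_tendsto has_sum_zeta has_sum_imp_summable by (intro conjI exI[of _ \<mu>]) (simp_all, blast)
qed

end
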